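(* Let $f$ be a transcendental entire function whose Fatou set $F(f)$ contains multiply connected components. (1) If $\lambda(f^2)<\infty$, where $f^2=f\circ f$, then $F(f)$ is uniformly bounded, i.e. $B_2(f)<\infty$. (2) Suppose that $F(f)$ contains at least two different orbits $\mathcal X$ and $\mathcal Y$ which consist only of multiply connected components, and suppose further that $\lambda(f)<\infty$. Then $F(f)$ is uniformly bounded, i.e. $B_2(f)<\infty$. (3) $B_0(f)=\infty$.
   Context: For a transcendental entire function $f$, $f^n$ denotes the $n$-th iterate of $f$. The Fatou set $F(f)$ is the set of $z\in\mathbb C$ such that $\{f^n\}_{n\ge1}$ is normal (in the sense of Montel, with the constant limit $\infty$ allowed) in some neighborhood of $z$; its connected components are called Fatou components. A component is multiply connected if it is not simply connected. For an entire function $g$, $M(r,g)=\max\{|g(z)|:|z|=r\}$, and the order of $g$ is $\lambda(g)=\limsup_{r\to\infty}\frac{\log\log M(r,g)}{\log r}$. Define $$B_0(f)=\sup_U\frac{\sup_{z\in U}(|z|+1)}{\inf_{w\in U}(|w|+1)},\qquad B_2(f)=\sup_U\frac{\sup_{z\in U}\log\log(|z|+30)}{\inf_{w\in U}\log(|w|+3)},$$ where $\sup_U$ is over all components $U$ of $F(f)$ (a term is $+\infty$ if $U$ is unbounded). $F(f)$ is called uniformly bounded if $B_2(f)<\infty$. A (nonempty) set $\mathcal X$ of Fatou components of $f$ is called an orbit if for any two components $U_1,U_2\in\mathcal X$ there exist positive integers $m,n$ with $f^m(U_1)=f^n(U_2)$. Two orbits $\mathcal X,\mathcal Y$ are different if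 they belong to different grand orbits, i.e. there are no $U\in\mathcal X$, $V\in\mathcal Y$ and positive integers $m,n$ with $f^m(U)=f^n(V)$. *)

theory Defs
  imports "HOL-Complex_Analysis.Complex_Analysis" "HOL-Computational_Algebra.Polynomial"
begin

definition transcendental_entire :: "(complex \<Rightarrow> complex) \<Rightarrow> bool" where
  "transcendental_entire f \<longleftrightarrow> f holomorphic_on UNIV \<and> (\<nexists>p. f = poly p)"

definition locally_uniform_limit ::
    "complex set \<Rightarrow> (nat \<Rightarrow> complex \<Rightarrow> complex) \<Rightarrow> (complex \<Rightarrow> complex) \<Rightarrow> bool" where
  "locally_uniform_limit W g h \<longleftrightarrow>
     (\<forall>K. compact K \<and> K \<subseteq> W \<longrightarrow> uniform_limit K g h sequentially)"

definition locally_uniform_limit_infinity ::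
    "complex set \<Rightarrow> (nat \<Rightarrow> complex \<Rightarrow> complex) \<Rightarrow> bool" where
  "locally_uniform_limit_infinity W g \<longleftrightarrow>
     (\<forall>K. compact K \<and> K \<subseteq> W \<longrightarrow>
       (\<forall>B::real. \<forall>\<^sub>F n in sequentially. \<forall>z\<in>K. B \<le> norm (g n z)))"

text \<open>
  The sequences drawn from the family may repeat members. On a disconnected set
  the limit is here required to be finite on all components or infinite on all of them;
  since normality is only used in \<open>Fatou_set\<close>, where the neighbourhood can be shrunk to a disc,
  this makes no difference.
\<close>
definition normal_family_on :: "complex set \<Rightarrow> (complex \<Rightarrow> complex) set \<Rightarrow> bool" where
  "normal_family_on W \<F> \<longleftrightarrow>
     (\<forall>g :: nat \<Rightarrow> complex \<Rightarrow> complex. range g \<subseteq> \<F> \<longrightarrow>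
       (\<exists>r :: nat \<Rightarrow> nat. strict_mono r \<and>
         ((\<exists>h. h holomorphic_on W \<and> locally_uniform_limit W (g \<circ> r) h) \<or>
          locally_uniform_limit_infinity W (g \<circ> r))))"

definition Fatou_set :: "(complex \<Rightarrow> complex) \<Rightarrow> complex set" where
  "Fatou_set f =
     {z. \<exists>W. open W \<and> z \<in> W \<and> normal_family_on W {f ^^ n | n. 1 \<le> n}}"

definition Fatou_components :: "(complex \<Rightarrow> complex) \<Rightarrow> complex set set" where
  "Fatou_components f = components (Fatou_set f)"

definition multiply_connected :: "complex set \<Rightarrow> bool" where
  "multiply_connected U \<longleftrightarrow> \<not> simply_connected U"

text \<open>For continuous \<open>g\<close> and \<open>r \<ge> 0\<close> the supremum is attained, so it is the maximum modulus.\<close>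
definition max_modulus :: "real \<Rightarrow> (complex \<Rightarrow> complex) \<Rightarrow> real" where
  "max_modulus r g = (SUP z\<in>sphere 0 r. norm (g z))"

definition growth_order :: "(complex \<Rightarrow> complex) \<Rightarrow> ereal" where
  "growth_order g = Limsup at_top (\<lambda>r::real. ereal (ln (ln (max_modulus r g)) / ln r))"

text \<open>
  In the next two definitions each infimum is a positive real number, since components are
  nonempty, and the supremum, hence the quotient, is \<open>\<infinity>\<close> if \<open>U\<close> is unbounded.
\<close>
definition B0 :: "(complex \<Rightarrow> complex) \<Rightarrow> ereal" where
  "B0 f = (SUP U\<in>Fatou_components f.
     (SUP z\<in>U. ereal (norm z + 1)) / (INF w\<in>U. ereal (norm w + 1)))"

definition B2 :: "(complex \<Rightarrow> complex) \<Rightarrow> ereal" where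
  "B2 f = (SUP U\<in>Fatou_components f.
     (SUP z\<in>U. ereal (ln (ln (norm z + 30)))) / (INF w\<in>U. ereal (ln (norm w + 3))))"

definition Fatou_uniformly_bounded :: "(complex \<Rightarrow> complex) \<Rightarrow> bool" where
  "Fatou_uniformly_bounded f \<longleftrightarrow> B2 f < \<infinity>"

text \<open>
  Here \<open>f\<^sup>m(U)\<close> is the actual image. In general it is only contained in a Fatou component,
  possibly omitting a point of it, but for multiply connected \<open>U\<close> it is the whole component.
\<close>
definition Fatou_orbit :: "(complex \<Rightarrow> complex) \<Rightarrow> complex set set \<Rightarrow> bool" where
  "Fatou_orbit f \<X> \<longleftrightarrow> \<X> \<noteq> {} \<and> \<X> \<subseteq> Fatou_components f \<and>
     (\<forall>U\<in>\<X>. \<forall>V\<in>\<X>. \<exists>m n. 1 \<le> m \<and> 1 \<le> n \<and> (f ^^ m) ` U = (f ^^ n) ` V)"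

definition different_orbits ::
    "(complex \<Rightarrow> complex) \<Rightarrow> complex set set \<Rightarrow> complex set set \<Rightarrow> bool" where
  "different_orbits f \<X> \<Y> \<longleftrightarrow>
     \<not> (\<exists>U\<in>\<X>. \<exists>V\<in>\<Y>. \<exists>m n. 1 \<le> m \<and> 1 \<le> n \<and> (f ^^ m) ` U = (f ^^ n) ` V)"

end

theory Submission
  imports Defs
begin

text \<open>
  A bounded complementary component of \<open>U\<close> lies in a bounded domain \<open>D\<close> with \<open>frontier D \<subseteq> U\<close>
  that meets the Julia set. If some subsequence of the iterates were bounded at a point of \<open>U\<close>, then
  a further one would be bounded on \<open>frontier D\<close>, hence on \<open>D\<close>; but by Schottky's theorem some image
  of \<open>D\<close> contains a large circle, and the maximum modulus of the iterates on such a circle tends to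
  \<open>\<infinity>\<close>. So \<open>f ^^ n\<close> tends to \<open>\<infinity>\<close> on \<open>U\<close>, and \<open>(f ^^ n) ` D\<close> contains the disc of radius
  \<open>rmin n\<close>, the minimum of \<open>norm (f ^^ n)\<close> on \<open>frontier D\<close>. By Harnack's inequality the maximum
  \<open>rmax n\<close> is at most a power of \<open>rmin n\<close>, so a Fatou component meeting the disc of radius \<open>rmin n\<close> is
  enclosed by the images of \<open>frontier D\<close> under \<open>f ^^ n\<close> or \<open>f ^^ Suc n\<close>, whose sizes are
  controlled by the order of \<open>f \<circ> f\<close>; with a second orbit at hand the order of \<open>f\<close> suffices.
\<close>

section \<open>Entire functions and their maximum modulus\<close>

text \<open>Winding numbers are avoided: an image of \<open>D\<close> is an open set whose frontier
  lies in the image of \<open>frontier D\<close>, and a connected set that misses this frontier lies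
  inside or outside. A component \<open>V\<close> meeting the disc of radius \<open>rmin n\<close>
  can thus fail to be enclosed at index \<open>n\<close> only by containing the image of
  \<open>U\<close> under \<open>f ^^ n\<close>. The obstacle is exactly this exceptional
  \<open>V\<close>; it is overcome because no component contains two of these images, so one of two
  consecutive indices works. If \<open>M\<close> is the last index with
  \<open>rmin M \<le> norm w\<close>, the candidates are \<open>M + 1\<close> and
  \<open>M + 2\<close>, reached from index \<open>M\<close> by \<open>f\<close> and by
  \<open>f \<circ> f\<close>. This is where the order of the second iterate comes from. With two
  different orbits, \<open>V\<close> cannot contain an image from each, so the first candidate of
  one of them already encloses it and a single application of \<open>f\<close> has to be
  estimated.\<close>

lemma max_modulus_ge:
  assumes "f holomorphic_on UNIV" "norm z \<le> r"
  shows "norm (f z) \<le> max_modulus r f"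
proof -
  have "continuous_on UNIV f" using assms(1) by (rule holomorphic_on_imp_continuous_on)
  then have cont: "continuous_on S f" for S by (rule continuous_on_subset) simp
  have bdd: "bdd_above ((\<lambda>z. norm (f z)) ` sphere 0 r)"
    by (intro compact_imp_bounded[THEN bounded_imp_bdd_above] compact_continuous_image
        continuous_on_norm cont compact_sphere)
  have *: "norm (f w) \<le> max_modulus r f" if "w \<in> sphere 0 r" for w
    unfolding max_modulus_def using that bdd by (rule cSUP_upper)
  show ?thesis
  proof (rule maximum_modulus_frontier[of f "cball 0 r"])
    show "norm (f w) \<le> max_modulus r f" if "w \<in> frontier (cball 0 r)" for w
      using that * by (simp add: frontier_cball)
    show "f holomorphic_on interior (cball 0 r)" using assms(1) holomorphic_on_subset by blast
  qed (use assms in \<open>auto intro: cont\<close>)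
qed

lemma max_modulus_attained:
  assumes "f holomorphic_on UNIV" "0 \<le> r"
  obtains z where "norm z = r" "norm (f z) = max_modulus r f"
proof -
  have "continuous_on UNIV f" using assms(1) by (rule holomorphic_on_imp_continuous_on)
  then have "continuous_on (sphere 0 r) (\<lambda>z. norm (f z))"
    by (intro continuous_on_norm) (erule continuous_on_subset, simp)
  moreover have "sphere (0::complex) r \<noteq> {}" using assms(2) by simp
  ultimately obtain z where z: "z \<in> sphere 0 r" "\<And>w. w \<in> sphere 0 r \<Longrightarrow> norm (f w) \<le> norm (f z)"
    using continuous_attains_sup[OF compact_sphere] by metis
  have "max_modulus r f = norm (f z)"
    unfolding max_modulus_def using z by (intro cSup_eq_maximum) auto
  then show ?thesis using z that by auto
qed

lemma max_modulus_le:
  assumes "f holomorphic_on UNIV" "0 \<le> r" "\<And>z. norm z = r \<Longrightarrow> norm (f z) \<le> B"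
  shows "max_modulus r f \<le> B"
  using max_modulus_attained[OF assms(1,2)] assms(3) by metis

lemma max_modulus_nonneg:
  assumes "f holomorphic_on UNIV" "0 \<le> r"
  shows "0 \<le> max_modulus r f"
  using max_modulus_attained[OF assms] norm_ge_zero by metis

lemma max_modulus_mono:
  assumes "f holomorphic_on UNIV" "0 \<le> r" "r \<le> s"
  shows "max_modulus r f \<le> max_modulus s f"
  using assms by (intro max_modulus_le max_modulus_ge) auto

section \<open>Polynomial growth and Taylor remainders of entire functions\<close>

lemma entire_minus_value_div:
  assumes "f holomorphic_on UNIV"
  obtains h where "h holomorphic_on UNIV" "\<And>z. f z = f 0 + z * h z"
proof
  define h where "h z = (if z = 0 then deriv f 0 else (f z - f 0) / z)" for z
  have "((\<lambda>z. f z - f 0) has_field_derivative deriv f 0) (at 0)"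
    using assms by (auto intro!: derivative_eq_intros holomorphic_derivI)
  then have d: "deriv (\<lambda>z. f z - f 0) 0 = deriv f 0" by (rule DERIV_imp_deriv)
  show "h holomorphic_on UNIV"
    by (rule pole_theorem_open_0[of "\<lambda>z. f z - f 0" _ 0])
       (auto simp: h_def d intro!: holomorphic_intros assms)
  show "f z = f 0 + z * h z" for z by (simp add: h_def)
qed

text \<open>Dividing \<open>f z - f 0\<close> by \<open>z\<close> lowers the exponent by one, down
  to Liouville's theorem; frontier points have norm at least 1 because \<open>D\<close> is taken to
  contain the unit disc. Exhausting sets other than discs are allowed since the later application
  controls \<open>f\<close> only on frontiers of images of a hole.\<close>

lemma polynomial_if_growth_on_frontiers:
  assumes "f holomorphic_on UNIV"
    and "\<And>R::real. \<exists>D. open D \<and> bounded D \<and> ball 0 R \<subseteq> D \<and>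
           (\<forall>w\<in>frontier D. norm (f w) \<le> A * norm w ^ k)"
  shows "\<exists>p. f = poly p"
  using assms
proof (induction k arbitrary: f A)
  case 0
  have "norm (f z) \<le> A" for z
  proof -
    obtain D where D: "open D" "bounded D" "ball 0 (norm z + 1) \<subseteq> D"
      "\<forall>w\<in>frontier D. norm (f w) \<le> A * norm w ^ 0"
      using 0(2)[of "norm z + 1"] by blast
    show ?thesis
    proof (rule maximum_modulus_frontier[of f D])
      show "f holomorphic_on interior D" using 0(1) holomorphic_on_subset by blast
      show "continuous_on (closure D) f"
        using 0(1) holomorphic_on_imp_continuous_on continuous_on_subset by blast
      show "z \<in> D" using D(3) by (auto simp: subset_iff)
    qed (use D in auto)
  qed
  then have "bounded (range f)" by (auto intro: boundedI)
  then have "f constant_on UNIV" using Liouville_theorem[OF 0(1)] by blast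
  then obtain c where "f = (\<lambda>_. c)" unfolding constant_on_def by auto
  then have "f = poly [:c:]" by auto
  then show ?case by blast
next
  case (Suc k)
  obtain h where h: "h holomorphic_on UNIV" "\<And>z. f z = f 0 + z * h z"
    using entire_minus_value_div[OF Suc.prems(1)] by metis
  have "\<exists>D. open D \<and> bounded D \<and> ball 0 R \<subseteq> D \<and>
           (\<forall>w\<in>frontier D. norm (h w) \<le> (A + norm (f 0)) * norm w ^ k)" for R
  proof -
    obtain D where D: "open D" "bounded D" "ball 0 (max R 1) \<subseteq> D"
      "\<forall>w\<in>frontier D. norm (f w) \<le> A * norm w ^ Suc k"
      using Suc.prems(2)[of "max R 1"] by blast
    have "norm (h w) \<le> (A + norm (f 0)) * norm w ^ k" if "w \<in> frontier D" for w
    proof -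
      have "w \<notin> D" using that D(1) by (simp add: frontier_def interior_open)
      then have w: "1 \<le> norm w" using D(3) by (auto simp: subset_iff not_less)
      have "norm w * norm (h w) = norm (f w - f 0)" using h(2)[of w] by (simp add: norm_mult)
      also have "\<dots> \<le> A * norm w ^ Suc k + norm (f 0)"
        using D(4) that norm_triangle_ineq4[of "f w" "f 0"] by fastforce
      also have "norm (f 0) \<le> norm (f 0) * norm w ^ Suc k"
        using one_le_power[OF w, of "Suc k"] by (simp add: mult_le_cancel_left1)
      finally have "norm w * norm (h w) \<le> norm w * ((A + norm (f 0)) * norm w ^ k)"
        by (simp add: algebra_simps)
      then show ?thesis using w by (subst (asm) mult_le_cancel_left_pos) auto
    qed
    moreover have "ball 0 R \<subseteq> D" using D(3) by (auto simp: subset_iff)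
    ultimately show ?thesis using D by blast
  qed
  then obtain p where p: "h = poly p" using Suc.IH[OF h(1)] by blast
  have "f z = poly (pCons (f 0) p) z" for z using h(2)[of z] p by simp
  then have "f = poly (pCons (f 0) p)" by blast
  then show ?case by blast
qed

lemma transcendental_growth:
  assumes "transcendental_entire f"
  shows "\<exists>R0\<ge>1. \<forall>r\<ge>R0. A * r ^ k < max_modulus r f"
proof (rule ccontr)
  have hol: "f holomorphic_on UNIV" and np: "\<nexists>p. f = poly p"
    using assms by (auto simp: transcendental_entire_def)
  assume neg: "\<not> ?thesis"
  have "\<exists>D. open D \<and> bounded D \<and> ball 0 R \<subseteq> D \<and>
           (\<forall>w\<in>frontier D. norm (f w) \<le> A * norm w ^ k)" for R
  proof -
    obtain r where r: "max R 1 \<le> r" "max_modulus r f \<le> A * r ^ k"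
      using neg by (metis not_less max.cobounded2)
    have "norm (f w) \<le> A * norm w ^ k" if "w \<in> frontier (ball 0 r)" for w
      using that r max_modulus_ge[OF hol, of w r] by (auto simp: frontier_ball)
    then show ?thesis using r by (intro exI[of _ "ball 0 r"]) auto
  qed
  then show False using polynomial_if_growth_on_frontiers[OF hol] np by blast
qed

text \<open>\<open>p\<close> arises as the Taylor polynomial of degree below \<open>k\<close>; only
  its growth outside the unit disc is recorded, which is all that the comparison of maximum moduli
  needs.\<close>

lemma entire_split_off_power:
  assumes "f holomorphic_on UNIV"
  shows "\<exists>p h A. h holomorphic_on UNIV \<and> (\<forall>z. f z = p z + z ^ k * h z)
     \<and> (\<forall>z. 1 \<le> norm z \<longrightarrow> norm (p z) \<le> A * norm z ^ k) \<and> (0::real) \<le> A"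
  using assms
proof (induction k arbitrary: f)
  case 0
  then show ?case by (intro exI[of _ "\<lambda>_. 0"] exI[of _ f] exI[of _ 0]) auto
next
  case (Suc k)
  obtain h where h: "h holomorphic_on UNIV" "\<And>z. f z = f 0 + z * h z"
    using entire_minus_value_div[OF Suc.prems(1)] by metis
  obtain p h' A where IH: "h' holomorphic_on UNIV" "\<And>z. h z = p z + z ^ k * h' z"
    "\<And>z. 1 \<le> norm z \<Longrightarrow> norm (p z) \<le> A * norm z ^ k" "0 \<le> A"
    using Suc.IH[OF h(1)] by blast
  have "norm (f 0 + z * p z) \<le> (norm (f 0) + A) * norm z ^ Suc k" if z: "1 \<le> norm z" for z
  proof -
    have "norm (f 0 + z * p z) \<le> norm (f 0) * 1 + norm z * (A * norm z ^ k)"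
      using IH(3)[OF z] by (intro norm_triangle_le) (auto simp: norm_mult intro!: mult_left_mono)
    also have "\<dots> \<le> norm (f 0) * norm z ^ Suc k + norm z * (A * norm z ^ k)"
      using one_le_power[OF z, of "Suc k"] by (intro add_right_mono mult_left_mono) auto
    finally show ?thesis by (simp add: algebra_simps)
  qed
  moreover have "f z = (f 0 + z * p z) + z ^ Suc k * h' z" for z
    by (subst h(2)) (simp add: IH(2) algebra_simps)
  moreover have "0 \<le> norm (f 0) + A" using IH(4) by simp
  ultimately show ?case using IH(1)
    by (intro exI[of _ "\<lambda>z. f 0 + z * p z"] exI[of _ h'] exI[of _ "norm (f 0) + A"] conjI) blast+
qed

text \<open>In \<open>f z = p z + z ^ k * h z\<close>, halving the radius shrinks
  \<open>z ^ k\<close> by the factor \<open>2 ^ k\<close> while the maximum of \<open>h\<close> does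
  not grow, and \<open>p\<close> is negligible against \<open>max_modulus r f\<close> because
  \<open>f\<close> is transcendental.\<close>

lemma max_modulus_half:
  assumes "transcendental_entire f" "0 < \<epsilon>"
  shows "\<exists>R0\<ge>1. \<forall>r\<ge>R0. max_modulus (r / 2) f \<le> \<epsilon> * max_modulus r f"
proof -
  have hol: "f holomorphic_on UNIV" using assms by (auto simp: transcendental_entire_def)
  obtain k where k: "(1/2::real) ^ k < \<epsilon> / 2"
    using real_arch_pow_inv[of "\<epsilon> / 2" "1/2"] assms(2) by auto
  obtain p h A where ph: "h holomorphic_on UNIV" "\<And>z. f z = p z + z ^ k * h z"
    "\<And>z. 1 \<le> norm z \<Longrightarrow> norm (p z) \<le> A * norm z ^ k" "0 \<le> A"
    using entire_split_off_power[OF hol, of k] by blast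
  \<comment> \<open>The estimate produces the term \<open>A * r ^ k\<close> twice; the factor
    \<open>4 * A / \<epsilon>\<close> makes their sum at most \<open>\<epsilon> / 2\<close> times
    the maximum modulus.\<close>
  obtain R0 where R0: "R0 \<ge> 1" "\<And>r. r \<ge> R0 \<Longrightarrow> (4 * A / \<epsilon>) * r ^ k < max_modulus r f"
    using transcendental_growth[OF assms(1)] by metis
  have "max_modulus (r / 2) f \<le> \<epsilon> * max_modulus r f" if r: "r \<ge> max R0 2" for r
  proof (rule max_modulus_le[OF hol])
    have r0: "0 < r" using r by simp
    show "0 \<le> r / 2" using r by simp
    fix z :: complex assume z: "norm z = r / 2"
    obtain w where w: "norm w = r" "norm (h w) = max_modulus r h"
      using max_modulus_attained[OF ph(1), of r] r0 by auto
    have "r ^ k * norm (h w) = norm (f w - p w)" using ph(2)[of w] w by (simp add: norm_mult norm_power)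
    also have "\<dots> \<le> max_modulus r f + A * r ^ k"
      using norm_triangle_ineq4[of "f w" "p w"] max_modulus_ge[OF hol, of w r] ph(3)[of w] w r by simp
    finally have 1: "r ^ k * norm (h w) \<le> max_modulus r f + A * r ^ k" .
    have hz: "norm (h z) \<le> norm (h w)" using max_modulus_ge[OF ph(1), of z r] w z r0 by simp
    have "norm (f z) \<le> norm (p z) + norm z ^ k * norm (h z)"
      unfolding ph(2)[of z] by (metis norm_mult norm_power norm_triangle_ineq)
    also have "\<dots> \<le> A * (r/2) ^ k + (r/2) ^ k * norm (h w)"
      using ph(3)[of z] hz r0 r unfolding z by (intro add_mono mult_left_mono) auto
    also have "\<dots> \<le> A * r ^ k + (1/2) ^ k * (r ^ k * norm (h w))"
    proof (intro add_mono mult_left_mono)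
      show "(r / 2) ^ k \<le> r ^ k" using r0 by (intro power_mono) auto
    qed (use ph(4) in \<open>auto simp: power_divide\<close>)
    also have "\<dots> \<le> A * r ^ k + ((1/2) ^ k * max_modulus r f + 1 * (A * r ^ k))"
    proof -
      have "(1/2) ^ k * (r ^ k * norm (h w)) \<le> (1/2) ^ k * (max_modulus r f + A * r ^ k)"
        using 1 by (intro mult_left_mono) auto
      also have "\<dots> \<le> (1/2) ^ k * max_modulus r f + 1 * (A * r ^ k)"
        unfolding distrib_left using ph(4) r0
        by (intro add_mono mult_right_mono) (auto intro: power_le_one max_modulus_nonneg hol)
      finally show ?thesis by simp
    qed
    also have "\<dots> = (\<epsilon> / 2) * ((4 * A / \<epsilon>) * r ^ k) + (1/2) ^ k * max_modulus r f"
      using assms(2) by (simp add: field_simps)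
    also have "\<dots> \<le> (\<epsilon> / 2) * max_modulus r f + (\<epsilon> / 2) * max_modulus r f"
    proof (intro add_mono mult_left_mono mult_right_mono)
      show "0 \<le> max_modulus r f" using r0 by (intro max_modulus_nonneg hol) simp
    qed (use R0(2)[of r] r k assms(2) in auto)
    finally show "norm (f z) \<le> \<epsilon> * max_modulus r f" by simp
  qed
  then show ?thesis by (intro exI[of _ "max R0 2"]) auto
qed

section \<open>Schottky's theorem and coverings of large circles\<close>

lemma Schottky_disc:
  assumes hol: "h holomorphic_on ball a \<rho>" and "0 < \<rho>" "0 < R" "norm w1 = R" "norm w2 = 2 * R"
    and omit: "w1 \<notin> h ` ball a \<rho>" "w2 \<notin> h ` ball a \<rho>"
    and ha: "norm (h a) \<le> B" and z: "dist a z \<le> \<rho> / 3"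
  shows "norm (h z) \<le> R * (1 + 3 * exp (pi * exp (pi * (2 + 2 * ((B + R) / R) + 12))))"
proof -
  \<comment> \<open>At this scale the closed unit disc lands inside the given disc, and
    \<open>dist a z \<le> \<rho> / 3\<close> becomes \<open>norm u \<le> 1/2\<close>.\<close>
  define s where "s = 2 * \<rho> / 3"
  have s: "0 < s" "s < \<rho>" using \<open>0 < \<rho>\<close> by (auto simp: s_def)
  have d: "R \<le> norm (w2 - w1)" "norm (w2 - w1) \<le> 3 * R"
    using norm_triangle_ineq4[of w2 w1] norm_triangle_ineq2[of w2 w1] assms by auto
  then have d0: "w2 - w1 \<noteq> 0" "0 < norm (w2 - w1)" using \<open>0 < R\<close> by auto
  \<comment> \<open>The normalised map omits 0 and 1. The moduli \<open>R\<close> and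
    \<open>2 * R\<close> of the omitted values keep \<open>norm (w2 - w1)\<close> between
    \<open>R\<close> and \<open>3 * R\<close>, so the bound depends on \<open>R\<close> and
    \<open>B\<close> but not on the omitted points.\<close>
  define F where "F u = (h (a + of_real s * u) - w1) / (w2 - w1)" for u
  have inb: "a + of_real s * u \<in> ball a \<rho>" if "u \<in> cball 0 1" for u
  proof -
    have "dist a (a + of_real s * u) = s * norm u" using s by (simp add: dist_norm norm_mult)
    also have "\<dots> \<le> s * 1" using that s by (intro mult_left_mono) auto
    finally show ?thesis using s by simp
  qed
  define u where "u = (z - a) / of_real s"
  have zu: "z = a + of_real s * u" using s by (simp add: u_def)
  have "norm (F u) \<le> exp (pi * exp (pi * (2 + 2 * ((B + R) / R) + 12 * (1/2) / (1 - 1/2))))"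
  proof (rule Schottky[of F "(B + R) / R" "1/2" u])
    have "(h \<circ> (\<lambda>u. a + of_real s * u)) holomorphic_on cball 0 1"
      by (rule holomorphic_on_compose_gen[OF _ hol]) (use inb in \<open>auto intro!: holomorphic_intros\<close>)
    then show "F holomorphic_on cball 0 1"
      unfolding F_def o_def using d0 by (auto intro!: holomorphic_intros)
    have "norm (F 0) = norm (h a - w1) / norm (w2 - w1)" by (simp add: F_def norm_divide)
    also have "\<dots> \<le> (B + R) / R"
      using norm_triangle_ineq4[of "h a" w1] ha assms d order_trans[OF norm_ge_zero ha]
      by (intro frac_le) auto
    finally show "norm (F 0) \<le> (B + R) / R" .
    show "\<not> (F v = 0 \<or> F v = 1)" if "v \<in> cball 0 1" for v
      using omit inb[OF that] d0(1) by (auto simp: F_def field_simps)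
    have "norm u = dist a z / s" using s by (simp add: u_def norm_divide dist_norm norm_minus_commute)
    also have "\<dots> \<le> 1/2" using z s(1) \<open>0 < \<rho>\<close> by (simp add: s_def field_simps)
    finally show "norm u \<le> 1/2" .
  qed auto
  then have F: "norm (F u) \<le> exp (pi * exp (pi * (2 + 2 * ((B + R) / R) + 12)))" (is "_ \<le> ?L") by simp
  have "h z = w1 + (w2 - w1) * F u" using d0(1) zu by (simp add: F_def)
  then have "norm (h z) \<le> R + norm (w2 - w1) * norm (F u)"
    using norm_triangle_ineq[of w1 "(w2 - w1) * F u"] assms by (simp add: norm_mult)
  also have "\<dots> \<le> R + (3 * R) * ?L" using d F assms by (intro add_left_mono mult_mono) auto
  finally show ?thesis by (simp add: algebra_simps)
qed

text \<open>A form of Bohr's covering theorem: by Schottky, a function that misses a point of each of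
  two circles and is small at the origin cannot be large near the origin.\<close>
lemma covers_large_circle:
  assumes "transcendental_entire f"
  shows "\<exists>\<rho>0\<ge>1. \<forall>\<rho>\<ge>\<rho>0. \<exists>s\<ge>2 * \<rho>. sphere 0 s \<subseteq> f ` ball 0 \<rho>"
proof -
  have hol: "f holomorphic_on UNIV" using assms by (auto simp: transcendental_entire_def)
  define L where "L = 1 + 3 * exp (pi * exp (pi * (2 + 2 * 2 + 12)))"
  obtain R0 where R0: "R0 \<ge> 1" "\<And>r. r \<ge> R0 \<Longrightarrow> 6 * L * r ^ 1 < max_modulus r f"
    using transcendental_growth[OF assms] by metis
  have "\<exists>s\<ge>2 * \<rho>. sphere 0 s \<subseteq> f ` ball 0 \<rho>" if \<rho>: "\<rho> \<ge> max (3 * R0) (norm (f 0))" for \<rho>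
  proof (rule ccontr)
    assume neg: "\<not> ?thesis"
    have "\<not> sphere 0 (2 * \<rho>) \<subseteq> f ` ball 0 \<rho>" "\<not> sphere 0 (2 * (2 * \<rho>)) \<subseteq> f ` ball 0 \<rho>"
      using neg \<rho> R0(1) by auto
    then obtain w1 w2 where w: "norm w1 = 2 * \<rho>" "norm w2 = 2 * (2 * \<rho>)"
      "w1 \<notin> f ` ball 0 \<rho>" "w2 \<notin> f ` ball 0 \<rho>" by (auto simp: subset_iff)
    obtain z where z: "norm z = \<rho> / 3" "norm (f z) = max_modulus (\<rho> / 3) f"
      using max_modulus_attained[OF hol, of "\<rho> / 3"] \<rho> R0(1) by auto
    \<comment> \<open>With \<open>R = B = 2 * \<rho>\<close> the quotient in Schottky's bound is 2,
      so the bound is \<open>2 * \<rho> * L\<close>. This equals \<open>6 * L\<close> times the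
      radius \<open>\<rho> / 3\<close>, which explains the constant in the choice of
      \<open>R0\<close>.\<close>
    have "norm (f z) \<le> 2 * \<rho> * (1 + 3 * exp (pi * exp (pi * (2 + 2 * ((2 * \<rho> + 2 * \<rho>) / (2 * \<rho>)) + 12))))"
      by (rule Schottky_disc[of f 0 \<rho> "2 * \<rho>" w1 w2 "2 * \<rho>" z])
         (use w z \<rho> R0(1) hol in \<open>auto intro: holomorphic_on_subset simp: dist_norm\<close>)
    also have "\<dots> = 2 * \<rho> * L" using \<rho> R0(1) by (simp add: L_def)
    finally show False using R0(2)[of "\<rho> / 3"] z(2) \<rho> by (simp add: mult.commute)
  qed
  then show ?thesis using R0(1) by (intro exI[of _ "max (3 * R0) (norm (f 0))"]) auto
qed

lemma holomorphic_funpow: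
  fixes f :: "complex \<Rightarrow> complex"
  assumes "f holomorphic_on UNIV"
  shows "(f ^^ n) holomorphic_on UNIV"
proof (induction n)
  case 0 show ?case by (simp add: id_def holomorphic_on_ident)
next
  case (Suc n)
  show ?case using holomorphic_on_compose_gen[OF Suc assms] by (simp add: o_def)
qed

text \<open>Each point of the covered circle of radius \<open>s \<ge> 2 * \<rho>\<close> has a
  preimage in the disc of radius \<open>\<rho>\<close>, so one more iteration doubles the lower
  bound. The threshold does not depend on \<open>k\<close>, as the escape argument requires.\<close>

lemma max_modulus_funpow_ge:
  assumes "transcendental_entire f"
  shows "\<exists>\<rho>0\<ge>1. \<forall>\<rho>\<ge>\<rho>0. \<forall>k. 2 ^ k * \<rho> \<le> max_modulus \<rho> (f ^^ k)"
proof -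
  have hol: "f holomorphic_on UNIV" using assms by (auto simp: transcendental_entire_def)
  obtain \<rho>0 where \<rho>0: "\<rho>0 \<ge> 1" "\<And>\<rho>. \<rho> \<ge> \<rho>0 \<Longrightarrow> \<exists>s\<ge>2 * \<rho>. sphere 0 s \<subseteq> f ` ball 0 \<rho>"
    using covers_large_circle[OF assms] by metis
  have "2 ^ k * \<rho> \<le> max_modulus \<rho> (f ^^ k)" if "\<rho> \<ge> \<rho>0" for k \<rho>
    using that
  proof (induction k arbitrary: \<rho>)
    case 0
    show ?case using max_modulus_ge[OF holomorphic_funpow[OF hol], of "of_real \<rho>" \<rho> 0] 0 \<rho>0(1)
      by (simp add: id_def)
  next
    case (Suc k)
    obtain s where s: "s \<ge> 2 * \<rho>" "sphere 0 s \<subseteq> f ` ball 0 \<rho>" using \<rho>0(2) Suc.prems by blast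
    obtain z where z: "norm z = s" "norm ((f ^^ k) z) = max_modulus s (f ^^ k)"
      using max_modulus_attained[OF holomorphic_funpow[OF hol], of s] s Suc.prems \<rho>0(1) by auto
    obtain w where w: "w \<in> ball 0 \<rho>" "z = f w" using s(2) z(1) by (auto simp: subset_iff)
    have "2 ^ Suc k * \<rho> \<le> 2 ^ k * s" using s by simp
    also have "\<dots> \<le> max_modulus s (f ^^ k)" using Suc.IH[of s] s Suc.prems \<rho>0(1) by simp
    also have "\<dots> = norm ((f ^^ Suc k) w)" using z w by (simp add: funpow_Suc_right del: funpow.simps)
    also have "\<dots> \<le> max_modulus \<rho> (f ^^ Suc k)"
      using w by (intro max_modulus_ge holomorphic_funpow hol) simp
    finally show ?case .
  qed
  then show ?thesis using \<rho>0(1) by blast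
qed

text \<open>A growth bound for \<open>f \<circ> f\<close> has to control \<open>f\<close> as well;
  the circle covered by the inner \<open>f\<close> is larger than the original one, so the outer
  \<open>f\<close> loses nothing.\<close>

lemma max_modulus_le_comp:
  assumes "transcendental_entire f"
  shows "\<exists>\<rho>0\<ge>1. \<forall>\<rho>\<ge>\<rho>0. max_modulus \<rho> f \<le> max_modulus \<rho> (f \<circ> f)"
proof -
  have hol: "f holomorphic_on UNIV" using assms by (auto simp: transcendental_entire_def)
  obtain \<rho>0 where \<rho>0: "\<rho>0 \<ge> 1" "\<And>\<rho>. \<rho> \<ge> \<rho>0 \<Longrightarrow> \<exists>s\<ge>2 * \<rho>. sphere 0 s \<subseteq> f ` ball 0 \<rho>"
    using covers_large_circle[OF assms] by metis
  have "max_modulus \<rho> f \<le> max_modulus \<rho> (f \<circ> f)" if "\<rho> \<ge> \<rho>0" for \<rho>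
  proof -
    obtain s where s: "s \<ge> 2 * \<rho>" "sphere 0 s \<subseteq> f ` ball 0 \<rho>" using \<rho>0(2) \<open>\<rho> \<ge> \<rho>0\<close> by blast
    obtain z where z: "norm z = s" "norm (f z) = max_modulus s f"
      using max_modulus_attained[OF hol, of s] s \<open>\<rho> \<ge> \<rho>0\<close> \<rho>0(1) by auto
    obtain w where w: "w \<in> ball 0 \<rho>" "z = f w" using s(2) z(1) by (auto simp: subset_iff)
    have "max_modulus \<rho> f \<le> max_modulus s f"
      using s that \<rho>0(1) by (intro max_modulus_mono hol) auto
    also have "\<dots> = norm ((f \<circ> f) w)" using z w by simp
    also have "\<dots> \<le> max_modulus \<rho> (f \<circ> f)"
      using w by (intro max_modulus_ge holomorphic_on_compose_gen[OF hol hol]) auto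
    finally show ?thesis .
  qed
  then show ?thesis using \<rho>0(1) by blast
qed

section \<open>Normality of the iterates and Fatou components\<close>

definition bounded_along :: "(complex \<Rightarrow> complex) \<Rightarrow> complex set \<Rightarrow> nat set \<Rightarrow> bool" where
  "bounded_along f A T \<longleftrightarrow> (\<exists>B. \<forall>n\<in>T. \<forall>w\<in>A. norm ((f ^^ n) w) \<le> B)"

definition escapes_along :: "(complex \<Rightarrow> complex) \<Rightarrow> complex set \<Rightarrow> nat set \<Rightarrow> bool" where
  "escapes_along f A T \<longleftrightarrow> (\<forall>B. finite {n\<in>T. \<exists>w\<in>A. norm ((f ^^ n) w) < B})"

text \<open>Normality in terms of index sets. No limit function occurs, so the property passes to
  images and preimages under \<open>f\<close> by a mere shift of the indices.\<close>

definition iterates_normal_on :: "(complex \<Rightarrow> complex) \<Rightarrow> complex set \<Rightarrow> bool" where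
  "iterates_normal_on f A \<longleftrightarrow>
     (\<forall>S. infinite S \<longrightarrow> (\<exists>T\<subseteq>S. infinite T \<and> (bounded_along f A T \<or> escapes_along f A T)))"

lemma iterates_normal_onE:
  assumes "iterates_normal_on f A" "infinite S"
  obtains T where "T \<subseteq> S" "infinite T" "bounded_along f A T \<or> escapes_along f A T"
  using assms(1)[unfolded iterates_normal_on_def, rule_format, OF assms(2)] by blast

lemma bounded_along_subset: "bounded_along f A T \<Longrightarrow> B \<subseteq> A \<Longrightarrow> T' \<subseteq> T \<Longrightarrow> bounded_along f B T'"
  unfolding bounded_along_def by blast

lemma bounded_along_Un:
  assumes "bounded_along f A T" "bounded_along f B T"
  shows "bounded_along f (A \<union> B) T"
proof -
  obtain a b where "\<forall>n\<in>T. \<forall>w\<in>A. norm ((f ^^ n) w) \<le> a" "\<forall>n\<in>T. \<forall>w\<in>B. norm ((f ^^ n) w) \<le> b"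
    using assms unfolding bounded_along_def by blast
  then show ?thesis unfolding bounded_along_def by (intro exI[of _ "max a b"]) (auto intro: max.coboundedI1 max.coboundedI2)
qed

lemma not_bounded_and_escapes_along:
  assumes "bounded_along f {z} T" "escapes_along f A T" "z \<in> A" "infinite T"
  shows False
proof -
  obtain B where B: "\<forall>n\<in>T. norm ((f ^^ n) z) \<le> B" using assms(1) by (auto simp: bounded_along_def)
  have "finite {n\<in>T. \<exists>w\<in>A. norm ((f ^^ n) w) < B + 1}" using assms(2) by (simp add: escapes_along_def)
  moreover have "{n\<in>T. \<exists>w\<in>A. norm ((f ^^ n) w) < B + 1} = T"
    using B assms(3) by (force intro: le_less_trans)
  ultimately show False using assms(4) by simp
qed

lemma bounded_along_Suc: "bounded_along f A (Suc ` T) \<longleftrightarrow> bounded_along f (f ` A) T"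
  by (simp add: bounded_along_def funpow_Suc_right del: funpow.simps)

lemma escapes_along_Suc: "escapes_along f A (Suc ` T) \<longleftrightarrow> escapes_along f (f ` A) T"
proof -
  have "{n \<in> Suc ` T. \<exists>w\<in>A. norm ((f ^^ n) w) < B} = Suc ` {n \<in> T. \<exists>w\<in>f ` A. norm ((f ^^ n) w) < B}" for B
  proof -
    have "{n \<in> Suc ` T. P n} = Suc ` {n \<in> T. P (Suc n)}" for P by blast
    then show ?thesis by (simp add: funpow_Suc_right del: funpow.simps)
  qed
  then show ?thesis by (simp add: escapes_along_def finite_image_iff)
qed

lemma infinite_Suc_vimage: "infinite S \<Longrightarrow> infinite {n. Suc n \<in> S}"
proof
  assume S: "infinite S" and "finite {n. Suc n \<in> S}"
  then have "finite (insert 0 (Suc ` {n. Suc n \<in> S}))" by simp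
  moreover have "S \<subseteq> insert 0 (Suc ` {n. Suc n \<in> S})"
  proof
    fix n assume "n \<in> S" then show "n \<in> insert 0 (Suc ` {n. Suc n \<in> S})" by (cases n) auto
  qed
  ultimately show False using S finite_subset by blast
qed

lemma escapes_along_subset:
  assumes "escapes_along f A T" "B \<subseteq> A"
  shows "escapes_along f B T"
  unfolding escapes_along_def
proof
  fix b
  have "finite {n\<in>T. \<exists>w\<in>A. norm ((f ^^ n) w) < b}" using assms(1) by (simp add: escapes_along_def)
  then show "finite {n\<in>T. \<exists>w\<in>B. norm ((f ^^ n) w) < b}"
    by (rule rev_finite_subset) (use assms(2) in blast)
qed

lemma iterates_normal_on_subset:
  assumes "iterates_normal_on f A" "B \<subseteq> A"
  shows "iterates_normal_on f B"
  unfolding iterates_normal_on_def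
proof (intro allI impI)
  fix S :: "nat set" assume "infinite S"
  then obtain T where T: "T \<subseteq> S" "infinite T" "bounded_along f A T \<or> escapes_along f A T"
    using assms(1) unfolding iterates_normal_on_def by blast
  have "bounded_along f B T \<or> escapes_along f B T"
    using T(3) bounded_along_subset[OF _ assms(2) order_refl] escapes_along_subset[OF _ assms(2)] by blast
  then show "\<exists>T\<subseteq>S. infinite T \<and> (bounded_along f B T \<or> escapes_along f B T)"
    using T by blast
qed

lemma iterates_normal_on_image:
  assumes "iterates_normal_on f A" "B \<subseteq> f ` A"
  shows "iterates_normal_on f B"
  unfolding iterates_normal_on_def
proof (intro allI impI)
  fix S :: "nat set" assume "infinite S"
  then have "infinite (Suc ` S)" by (simp add: finite_image_iff)
  then obtain T' where T': "T' \<subseteq> Suc ` S" "infinite T'" "bounded_along f A T' \<or> escapes_along f A T'"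
    using assms(1) unfolding iterates_normal_on_def by blast
  obtain T where T: "T \<subseteq> S" "T' = Suc ` T" using T'(1) by (auto simp: subset_image_iff)
  have "bounded_along f (f ` A) T \<or> escapes_along f (f ` A) T"
    using T'(3) by (simp add: T(2) bounded_along_Suc escapes_along_Suc)
  then have "bounded_along f B T \<or> escapes_along f B T"
    using bounded_along_subset[OF _ assms(2) order_refl] escapes_along_subset[OF _ assms(2)] by blast
  then show "\<exists>T\<subseteq>S. infinite T \<and> (bounded_along f B T \<or> escapes_along f B T)"
    using T T'(2) by (intro exI[of _ T]) (auto simp: finite_image_iff)
qed

lemma iterates_normal_on_vimage:
  assumes "iterates_normal_on f (f ` A)"
  shows "iterates_normal_on f A"
  unfolding iterates_normal_on_def
proof (intro allI impI)
  fix S :: "nat set" assume "infinite S"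
  then obtain T where T: "T \<subseteq> {n. Suc n \<in> S}" "infinite T" "bounded_along f (f ` A) T \<or> escapes_along f (f ` A) T"
    using assms infinite_Suc_vimage[of S] unfolding iterates_normal_on_def by blast
  then show "\<exists>T\<subseteq>S. infinite T \<and> (bounded_along f A T \<or> escapes_along f A T)"
    by (intro exI[of _ "Suc ` T"]) (auto simp: bounded_along_Suc escapes_along_Suc finite_image_iff)
qed

lemma Fatou_setD:
  assumes "z \<in> Fatou_set f"
  shows "\<exists>e>0. iterates_normal_on f (cball z e)"
proof -
  obtain W where W: "open W" "z \<in> W" "normal_family_on W {f ^^ n | n. 1 \<le> n}"
    using assms by (auto simp: Fatou_set_def)
  obtain e where e: "e > 0" "cball z e \<subseteq> W" using W open_contains_cball by blast
  have "iterates_normal_on f (cball z e)" unfolding iterates_normal_on_def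
  proof (intro allI impI)
    fix S :: "nat set" assume "infinite S"
    \<comment> \<open>The family in \<open>Fatou_set\<close> starts at \<open>n = 1\<close>, so
      index 0 is dropped before a subsequence is chosen.\<close>
    then have inf: "infinite (S - {0})" by simp
    then obtain q :: "nat \<Rightarrow> nat" where q: "strict_mono q" "\<And>n. q n \<in> S - {0}"
      using infinite_enumerate[OF inf] by blast
    have "range (\<lambda>n. f ^^ q n) \<subseteq> {f ^^ n | n. 1 \<le> n}"
      using q(2) by (force simp: Suc_le_eq)
    then obtain r :: "nat \<Rightarrow> nat" where r: "strict_mono r"
      "(\<exists>h. h holomorphic_on W \<and> locally_uniform_limit W ((\<lambda>n. f ^^ q n) \<circ> r) h) \<or>
          locally_uniform_limit_infinity W ((\<lambda>n. f ^^ q n) \<circ> r)"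
      using W(3) unfolding normal_family_on_def by blast
    have inj: "inj (q \<circ> r)" using q(1) r(1) by (simp add: strict_mono_imp_inj_on inj_compose)
    show "\<exists>T\<subseteq>S. infinite T \<and> (bounded_along f (cball z e) T \<or> escapes_along f (cball z e) T)"
      using r(2)
    proof
      assume "\<exists>h. h holomorphic_on W \<and> locally_uniform_limit W ((\<lambda>n. f ^^ q n) \<circ> r) h"
      then obtain h where h: "h holomorphic_on W"
        "uniform_limit (cball z e) ((\<lambda>n. f ^^ q n) \<circ> r) h sequentially"
        using e unfolding locally_uniform_limit_def by auto
      have "continuous_on (cball z e) h"
        using h(1) e(2) holomorphic_on_imp_continuous_on continuous_on_subset by blast
      then have "bounded (h ` cball z e)"
        by (intro compact_imp_bounded compact_continuous_image) auto
      then obtain B where B: "\<forall>w\<in>cball z e. norm (h w) \<le> B"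
        by (auto simp: bounded_iff)
      obtain N where N: "\<forall>n\<ge>N. \<forall>w\<in>cball z e. dist ((f ^^ q (r n)) w) (h w) < 1"
        using uniform_limitD[OF h(2), of 1] by (auto simp: eventually_sequentially)
      have "bounded_along f (cball z e) ((q \<circ> r) ` {N..})"
        unfolding bounded_along_def
      proof (intro exI ballI)
        fix n w assume "n \<in> (q \<circ> r) ` {N..}" "w \<in> cball z e"
        then have "dist ((f ^^ n) w) (h w) < 1" "norm (h w) \<le> B" using N B by auto
        then show "norm ((f ^^ n) w) \<le> B + 1"
          using norm_triangle_sub[of "(f ^^ n) w" "h w"] by (simp add: dist_norm)
      qed
      moreover have "infinite ((q \<circ> r) ` {N..})"
        using finite_image_iff[OF inj_on_subset[OF inj]] infinite_Ici by blast
      moreover have "(q \<circ> r) ` {N..} \<subseteq> S" using q(2) by auto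
      ultimately show ?thesis by blast
    next
      assume "locally_uniform_limit_infinity W ((\<lambda>n. f ^^ q n) \<circ> r)"
      then have lim: "\<forall>\<^sub>F n in sequentially. \<forall>w\<in>cball z e. B \<le> norm ((f ^^ q (r n)) w)" for B
        using e unfolding locally_uniform_limit_infinity_def by auto
      have "finite {n \<in> range (q \<circ> r). \<exists>w\<in>cball z e. norm ((f ^^ n) w) < B}" for B
      proof -
        obtain N where N: "\<forall>n\<ge>N. \<forall>w\<in>cball z e. B \<le> norm ((f ^^ q (r n)) w)"
          using lim[of B] by (auto simp: eventually_sequentially)
        have "{n \<in> range (q \<circ> r). \<exists>w\<in>cball z e. norm ((f ^^ n) w) < B} \<subseteq> (q \<circ> r) ` {..<N}"
        proof
          fix n assume "n \<in> {n \<in> range (q \<circ> r). \<exists>w\<in>cball z e. norm ((f ^^ n) w) < B}"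
          then obtain k w where k: "n = (q \<circ> r) k" "w \<in> cball z e" "norm ((f ^^ n) w) < B" by blast
          then have "k < N" using N by (metis comp_apply not_le)
          then show "n \<in> (q \<circ> r) ` {..<N}" using k(1) by blast
        qed
        then show ?thesis using finite_subset by blast
      qed
      then have "escapes_along f (cball z e) (range (q \<circ> r))" by (simp add: escapes_along_def)
      moreover have "infinite (range (q \<circ> r))" using inj finite_image_iff infinite_UNIV_nat by blast
      moreover have "range (q \<circ> r) \<subseteq> S" using q(2) by auto
      ultimately show ?thesis by blast
    qed
  qed
  then show ?thesis using e by blast
qed

lemma Fatou_setI:
  assumes hol: "f holomorphic_on UNIV" and "0 < e" and nrm: "iterates_normal_on f (cball z e)"
  shows "z \<in> Fatou_set f"
proof -
  have "normal_family_on (ball z e) {f ^^ n | n. 1 \<le> n}" unfolding normal_family_on_def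
  proof (intro allI impI)
    fix g :: "nat \<Rightarrow> complex \<Rightarrow> complex"
    assume "range g \<subseteq> {f ^^ n | n. 1 \<le> n}"
    then have "\<forall>k. \<exists>n. g k = f ^^ n" by blast
    then obtain m where m: "\<And>k. g k = f ^^ m k" by metis
    show "\<exists>r :: nat \<Rightarrow> nat. strict_mono r \<and>
         ((\<exists>h. h holomorphic_on ball z e \<and> locally_uniform_limit (ball z e) (g \<circ> r) h) \<or>
          locally_uniform_limit_infinity (ball z e) (g \<circ> r))"
    \<comment> \<open>A sequence from the family may repeat one member infinitely often and then has
      a constant subsequence. Otherwise its index map is finite-to-one with infinite range, and
      normality applies to that range.\<close>
    proof (cases "\<exists>n. infinite {k. m k = n}")
      case True
      then obtain n where n: "infinite {k. m k = n}" by blast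
      obtain r :: "nat \<Rightarrow> nat" where r: "strict_mono r" "\<And>k. m (r k) = n"
        using infinite_enumerate[OF n] by auto
      have "g \<circ> r = (\<lambda>_. f ^^ n)" using m r(2) by auto
      then have "locally_uniform_limit (ball z e) (g \<circ> r) (f ^^ n)"
        by (simp add: locally_uniform_limit_def uniform_limit_const)
      moreover have "(f ^^ n) holomorphic_on ball z e"
        using holomorphic_funpow[OF hol] holomorphic_on_subset by blast
      ultimately show ?thesis using r(1) by blast
    next
      case False
      then have fib: "finite {k. m k = n}" for n by blast
      have fibs: "finite {k. m k \<in> X}" if "finite X" for X
      proof -
        have "{k. m k \<in> X} = (\<Union>n\<in>X. {k. m k = n})" by auto
        then show ?thesis using fib that by simp
      qed
      have "infinite (range m)" using fibs[of "range m"] by auto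
      then obtain T where T: "T \<subseteq> range m" "infinite T"
        "bounded_along f (cball z e) T \<or> escapes_along f (cball z e) T"
        using nrm unfolding iterates_normal_on_def by blast
      have "T \<subseteq> m ` {k. m k \<in> T}" using T(1) by auto
      then have inf: "infinite {k. m k \<in> T}" using T(2) finite_subset by blast
      obtain r :: "nat \<Rightarrow> nat" where r: "strict_mono r" "\<And>k. m (r k) \<in> T"
        using infinite_enumerate[OF inf] by auto
      show ?thesis using T(3)
      proof
        assume "bounded_along f (cball z e) T"
        then obtain B where B: "\<forall>n\<in>T. \<forall>w\<in>cball z e. norm ((f ^^ n) w) \<le> B"
          by (auto simp: bounded_along_def)
        \<comment> \<open>Montel's theorem recovers the limit function that
          \<open>iterates_normal_on\<close> leaves out.\<close>
        obtain h r' where h: "h holomorphic_on ball z e" "strict_mono (r' :: nat \<Rightarrow> nat)"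
          "\<And>K. \<lbrakk>compact K; K \<subseteq> ball z e\<rbrakk> \<Longrightarrow> uniform_limit K ((g \<circ> r) \<circ> r') h sequentially"
        proof (rule Montel[of "ball z e" "(\<lambda>n. f ^^ n) ` T" "g \<circ> r"])
          show "\<exists>B. \<forall>h\<in>(\<lambda>n. f ^^ n) ` T. \<forall>z\<in>K. norm (h z) \<le> B" if "K \<subseteq> ball z e" for K
            using B that by (intro exI[of _ B]) auto
          show "h holomorphic_on ball z e" if "h \<in> (\<lambda>n. f ^^ n) ` T" for h
            using that holomorphic_funpow[OF hol] holomorphic_on_subset by blast
          show "range (g \<circ> r) \<subseteq> (\<lambda>n. f ^^ n) ` T" using m r(2) by auto
        qed auto
        then have "locally_uniform_limit (ball z e) (g \<circ> (r \<circ> r')) h"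
          by (simp add: locally_uniform_limit_def o_assoc)
        then show ?thesis using h(1) strict_mono_o[OF r(1) h(2)] by blast
      next
        assume esc: "escapes_along f (cball z e) T"
        have "\<forall>\<^sub>F n in sequentially. \<forall>w\<in>K. B \<le> norm ((g \<circ> r) n w)" if "K \<subseteq> ball z e" for K B
        proof -
          have fin: "finite {n\<in>T. \<exists>w\<in>cball z e. norm ((f ^^ n) w) < B}"
            using esc by (simp add: escapes_along_def)
          have "finite (r -` {k. m k \<in> {n\<in>T. \<exists>w\<in>cball z e. norm ((f ^^ n) w) < B}})"
            using finite_vimageI[OF fibs[OF fin] strict_mono_imp_inj_on[OF r(1)]] .
          then have "\<forall>\<^sub>F k in sequentially. k \<notin> r -` {k. m k \<in> {n\<in>T. \<exists>w\<in>cball z e. norm ((f ^^ n) w) < B}}"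
            by (simp add: eventually_cofinite cofinite_eq_sequentially[symmetric])
          then show ?thesis
          proof (rule eventually_mono)
            fix k assume k: "k \<notin> r -` {k. m k \<in> {n\<in>T. \<exists>w\<in>cball z e. norm ((f ^^ n) w) < B}}"
            have "B \<le> norm ((f ^^ m (r k)) w)" if "w \<in> K" for w
              using k r(2)[of k] \<open>K \<subseteq> ball z e\<close> that ball_subset_cball[of z e] by (auto simp: not_less)
            then show "\<forall>w\<in>K. B \<le> norm ((g \<circ> r) k w)" using m by simp
          qed
        qed
        then show ?thesis using r(1) by (auto simp: locally_uniform_limit_infinity_def)
      qed
    qed
  qed
  then show ?thesis using \<open>0 < e\<close> by (auto simp: Fatou_set_def intro!: exI[of _ "ball z e"])
qed

section \<open>Components of the Fatou set and their images\<close>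

lemma open_Fatou_set: "open (Fatou_set f)"
proof (subst open_subopen, intro ballI)
  fix z assume "z \<in> Fatou_set f"
  then obtain W where "open W" "z \<in> W" "normal_family_on W {f ^^ n | n. 1 \<le> n}"
    by (auto simp: Fatou_set_def)
  then show "\<exists>T. open T \<and> z \<in> T \<and> T \<subseteq> Fatou_set f" by (intro exI[of _ W]) (auto simp: Fatou_set_def)
qed

lemma Fatou_componentD:
  assumes "V \<in> Fatou_components f"
  shows "open V" "connected V" "V \<noteq> {}" "V \<subseteq> Fatou_set f"
  using assms open_components[OF open_Fatou_set] in_components_connected in_components_nonempty
    in_components_subset unfolding Fatou_components_def by blast+

lemma Fatou_component_maximal:
  assumes "V \<in> Fatou_components f" "connected C" "C \<subseteq> Fatou_set f" "C \<inter> V \<noteq> {}"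
  shows "C \<subseteq> V"
  using assms components_maximal unfolding Fatou_components_def by blast

lemma Fatou_components_eq:
  assumes "V \<in> Fatou_components f" "W \<in> Fatou_components f" "V \<inter> W \<noteq> {}"
  shows "V = W"
  using assms components_nonoverlap unfolding Fatou_components_def by blast

lemma in_some_Fatou_component:
  assumes "z \<in> Fatou_set f"
  obtains V where "V \<in> Fatou_components f" "z \<in> V"
  using assms Union_components[of "Fatou_set f"] unfolding Fatou_components_def by blast

lemma frontier_Fatou_component:
  assumes "V \<in> Fatou_components f"
  shows "frontier V \<inter> Fatou_set f = {}"
  using frontier_of_components_subset[of V "Fatou_set f"] assms open_Fatou_set[of f]
  by (auto simp: Fatou_components_def frontier_def interior_open)

lemma transcendental_not_constant:
  assumes "transcendental_entire f"
  shows "\<not> f constant_on UNIV"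
proof
  assume "f constant_on UNIV"
  then obtain c where "f = poly [:c:]" by (auto simp: constant_on_def fun_eq_iff)
  then show False using assms by (auto simp: transcendental_entire_def)
qed

lemma open_image_transcendental:
  assumes "transcendental_entire f" "open S"
  shows "open (f ` S)"
  using open_mapping_thm[of f UNIV S] assms transcendental_not_constant
  by (auto simp: transcendental_entire_def)

lemma open_image_funpow:
  assumes "transcendental_entire f" "open S"
  shows "open ((f ^^ n) ` S)"
proof (induction n)
  case (Suc n)
  then show ?case using open_image_transcendental[OF assms(1)] unfolding funpow.simps image_comp[symmetric] by blast
qed (use assms in simp)

text \<open>Forward invariance rests on the open mapping theorem, which puts a disc about
  \<open>f z\<close> inside the image of a disc about \<open>z\<close>; for the converse continuity
  is enough.\<close>

lemma Fatou_set_invariant: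
  assumes f: "transcendental_entire f"
  shows "f z \<in> Fatou_set f \<longleftrightarrow> z \<in> Fatou_set f"
proof
  have hol: "f holomorphic_on UNIV" using f by (simp add: transcendental_entire_def)
  {
    assume "z \<in> Fatou_set f"
    then obtain e where e: "e > 0" "iterates_normal_on f (cball z e)" using Fatou_setD by blast
    have "open (f ` ball z e)" "f z \<in> f ` ball z e"
      using open_image_transcendental[OF f] e(1) by auto
    then obtain d where d: "d > 0" "cball (f z) d \<subseteq> f ` ball z e" using open_contains_cball by blast
    have "f ` ball z e \<subseteq> f ` cball z e" by (intro image_mono ball_subset_cball)
    then have "iterates_normal_on f (cball (f z) d)"
      using d(2) by (intro iterates_normal_on_image[OF e(2)]) (rule subset_trans)
    then show "f z \<in> Fatou_set f" using Fatou_setI[OF hol d(1)] by blast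
  next
    assume "f z \<in> Fatou_set f"
    then obtain e where e: "e > 0" "iterates_normal_on f (cball (f z) e)" using Fatou_setD by blast
    have "isCont f z" using holomorphic_on_imp_continuous_on[OF hol] by (simp add: continuous_on_eq_continuous_at)
    then obtain d where d: "d > 0" "\<And>w. dist w z < d \<Longrightarrow> dist (f w) (f z) < e"
      using e(1) unfolding continuous_at_eps_delta by blast
    have "f ` cball z (d / 2) \<subseteq> cball (f z) e"
      using d by (force simp: dist_commute intro: less_imp_le)
    then have "iterates_normal_on f (f ` cball z (d / 2))"
      by (rule iterates_normal_on_subset[OF e(2)])
    then show "z \<in> Fatou_set f"
      using Fatou_setI[OF hol, of "d / 2", OF _ iterates_normal_on_vimage] d(1) by simp
  }
qed

lemma Fatou_set_funpow:
  assumes "transcendental_entire f"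
  shows "(f ^^ n) z \<in> Fatou_set f \<longleftrightarrow> z \<in> Fatou_set f"
  by (induction n) (simp_all add: Fatou_set_invariant[OF assms])

lemma connected_image_funpow:
  assumes "f holomorphic_on UNIV" "connected S"
  shows "connected ((f ^^ n) ` S)"
  using holomorphic_on_imp_continuous_on[OF holomorphic_funpow[OF assms(1)]] assms(2)
  by (intro connected_continuous_image) (auto intro: continuous_on_subset)

lemma image_funpow_subset_component:
  assumes f: "transcendental_entire f" and "U \<in> Fatou_components f" "V \<in> Fatou_components f"
    "z \<in> U" "(f ^^ n) z \<in> V"
  shows "(f ^^ n) ` U \<subseteq> V"
proof (rule Fatou_component_maximal[OF assms(3)])
  show "connected ((f ^^ n) ` U)"
    using f Fatou_componentD[OF assms(2)] by (intro connected_image_funpow) (auto simp: transcendental_entire_def)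
  show "(f ^^ n) ` U \<subseteq> Fatou_set f"
    using Fatou_componentD[OF assms(2)] Fatou_set_funpow[OF f] by auto
qed (use assms in auto)

text \<open>On a disc of normality, an index set bounded at one point has no infinite escaping
  subset, so a further infinite subset is bounded on the whole disc. This local equivalence spreads
  over the connected component.\<close>

lemma bounded_along_transfer:
  assumes V: "V \<in> Fatou_components f" and "z \<in> V" "w \<in> V"
  shows "(\<exists>T\<subseteq>S. infinite T \<and> bounded_along f {z} T) \<longleftrightarrow> (\<exists>T\<subseteq>S. infinite T \<and> bounded_along f {w} T)"
proof -
  define R where "R z w \<longleftrightarrow> (\<forall>S. (\<exists>T\<subseteq>S. infinite T \<and> bounded_along f {z} T) \<longleftrightarrow>
    (\<exists>T\<subseteq>S. infinite T \<and> bounded_along f {w} T))" for z w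
  have "R z w"
  proof (rule connected_equivalence_relation[OF Fatou_componentD(2)[OF V] assms(2,3)])
    fix a assume "a \<in> V"
    then have "a \<in> Fatou_set f" using Fatou_componentD(4)[OF V] by blast
    from Fatou_setD[OF this] obtain e where e: "e > 0" "iterates_normal_on f (cball a e)" by auto
    have *: "\<exists>T'\<subseteq>S. infinite T' \<and> bounded_along f {y} T'"
 if T: "T \<subseteq> S" "infinite T" "bounded_along f {x} T" "x \<in> cball a e" "y \<in> cball a e" for S T x y
    proof -
      obtain T' where T': "T' \<subseteq> T" "infinite T'" "bounded_along f (cball a e) T' \<or> escapes_along f (cball a e) T'"
        using iterates_normal_onE[OF e(2) T(2)] .
      have "bounded_along f {x} T'" using bounded_along_subset[OF that(3) order_refl T'(1)] .
      then have "\<not> escapes_along f (cball a e) T'"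
        using not_bounded_and_escapes_along that(4) T'(2) by metis
      then have "bounded_along f (cball a e) T'" using T'(3) by blast
      then have "bounded_along f {y} T'" by (rule bounded_along_subset) (use that(5) in auto)
      moreover have "T' \<subseteq> S" using T'(1) that(1) by (rule subset_trans)
      ultimately show ?thesis using T'(2) by blast
    qed
    have "R a x" if "x \<in> ball a e" for x
    proof -
      have x: "x \<in> cball a e" "a \<in> cball a e" using that e(1) by auto
      show ?thesis unfolding R_def using *[OF _ _ _ x] *[OF _ _ _ x(2,1)] by meson
    qed
    then show "\<exists>T. openin (top_of_set V) T \<and> a \<in> T \<and> (\<forall>x\<in>T. R a x)"
      using \<open>a \<in> V\<close> e(1) by (intro exI[of _ "V \<inter> ball a e"]) auto
  qed (auto simp: R_def)
  then show ?thesis by (simp add: R_def)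
qed

lemma normal_disc_cover:
  assumes V: "V \<in> Fatou_components f" and K: "compact K" "K \<subseteq> V"
  obtains X e where "finite X" "X \<subseteq> K" "K \<subseteq> (\<Union>x\<in>X. cball x (e x))"
    "\<And>x. x \<in> X \<Longrightarrow> e x > 0 \<and> iterates_normal_on f (cball x (e x))"
proof -
  have "K \<subseteq> Fatou_set f" using K(2) Fatou_componentD(4)[OF V] by (rule subset_trans)
  then have "\<forall>x\<in>K. \<exists>e>0. iterates_normal_on f (cball x e)" using Fatou_setD[of _ f] by (meson subsetD)
  then obtain e where e: "\<And>x. x \<in> K \<Longrightarrow> e x > 0 \<and> iterates_normal_on f (cball x (e x))" by metis
  have "K \<subseteq> (\<Union>x\<in>K. ball x (e x))" using e by force
  then obtain X where "X \<subseteq> K" "finite X" "K \<subseteq> (\<Union>x\<in>X. ball x (e x))"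
    using compactE_image[OF K(1), of K "\<lambda>x. ball x (e x)"] by (metis open_ball)
  then show ?thesis using that[of X e] e ball_subset_cball by blast
qed

text \<open>The index set is thinned once for each disc of a finite cover: transfer inside
  \<open>V\<close> bounds the orbit of the centre, and normality extends this to the disc.\<close>

lemma bounded_along_compact:
  assumes V: "V \<in> Fatou_components f" and K: "compact K" "K \<subseteq> V"
    and z: "z \<in> V" "infinite S" "bounded_along f {z} S"
  obtains T where "T \<subseteq> S" "infinite T" "bounded_along f K T"
proof -
  obtain X e where X: "finite X" "X \<subseteq> K" "K \<subseteq> (\<Union>x\<in>X. cball x (e x))"
    "\<And>x. x \<in> X \<Longrightarrow> e x > 0 \<and> iterates_normal_on f (cball x (e x))"
    using normal_disc_cover[OF V K] by metis
  have "\<exists>T\<subseteq>S. infinite T \<and> bounded_along f (\<Union>x\<in>Y. cball x (e x)) T" if "finite Y" "Y \<subseteq> X" for Y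
    using that
  proof (induction Y)
    case empty
    then show ?case using z(2) by (auto simp: bounded_along_def)
  next
    case (insert x Y)
    then obtain T where T: "T \<subseteq> S" "infinite T" "bounded_along f (\<Union>x\<in>Y. cball x (e x)) T" by auto
    have x: "x \<in> V" "e x > 0" "iterates_normal_on f (cball x (e x))" using insert.prems X K by auto
    have "bounded_along f {z} T" using bounded_along_subset[OF z(3) order_refl T(1)] .
    then obtain T1 where T1: "T1 \<subseteq> T" "infinite T1" "bounded_along f {x} T1"
      using bounded_along_transfer[OF V z(1) x(1), of T] T(2) by blast
    obtain T2 where T2: "T2 \<subseteq> T1" "infinite T2"
      "bounded_along f (cball x (e x)) T2 \<or> escapes_along f (cball x (e x)) T2"
      using iterates_normal_onE[OF x(3) T1(2)] .
    have "bounded_along f {x} T2" using bounded_along_subset[OF T1(3) order_refl T2(1)] .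
    then have "\<not> escapes_along f (cball x (e x)) T2"
      using not_bounded_and_escapes_along[of f x T2 "cball x (e x)"] x(2) T2(2) by auto
    then have "bounded_along f (cball x (e x)) T2" using T2(3) by blast
    moreover have "bounded_along f (\<Union>x\<in>Y. cball x (e x)) T2"
      using bounded_along_subset[OF T(3) order_refl subset_trans[OF T2(1) T1(1)]] .
    ultimately have "bounded_along f (\<Union>x\<in>insert x Y. cball x (e x)) T2"
      by (simp add: bounded_along_Un)
    moreover have "T2 \<subseteq> S" using T(1) T1(1) T2(1) by simp
    ultimately show ?case using T2(2) by blast
  qed
  from this[OF X(1) order_refl] obtain T
    where T: "T \<subseteq> S" "infinite T" "bounded_along f (\<Union>x\<in>X. cball x (e x)) T" by blast
  show ?thesis using that[OF T(1,2) bounded_along_subset[OF T(3) X(3) order_refl]] .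
qed

text \<open>By pigeonhole, failure for infinitely many \<open>n\<close> happens on one disc of a
  finite cover. There both alternatives of normality are impossible: a bounded part would transfer
  to \<open>z\<close>, and an escaping part contradicts the choice of the index set.\<close>

lemma iterates_exceed_on_compact:
  assumes V: "V \<in> Fatou_components f" and K: "compact K" "K \<subseteq> V"
    and z: "z \<in> V" "\<And>S. infinite S \<Longrightarrow> \<not> bounded_along f {z} S"
  shows "\<exists>N. \<forall>n\<ge>N. \<forall>w\<in>K. B \<le> norm ((f ^^ n) w)"
proof (rule ccontr)
  assume neg: "\<not> ?thesis"
  define S where "S A = {n. \<exists>w\<in>A. norm ((f ^^ n) w) < B}" for A
  have S: "infinite (S K)"
    unfolding infinite_nat_iff_unbounded_le S_def using neg by (force simp: not_le)
  obtain X e where X: "finite X" "X \<subseteq> K" "K \<subseteq> (\<Union>x\<in>X. cball x (e x))"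
    "\<And>x. x \<in> X \<Longrightarrow> e x > 0 \<and> iterates_normal_on f (cball x (e x))"
    using normal_disc_cover[OF V K] by metis
  have "S K \<subseteq> (\<Union>x\<in>X. S (cball x (e x)))" using X(3) unfolding S_def by blast
  then obtain x where x: "x \<in> X" "infinite (S (cball x (e x)))"
    using S X(1) finite_subset by blast
  obtain T where T: "T \<subseteq> S (cball x (e x))" "infinite T"
    "bounded_along f (cball x (e x)) T \<or> escapes_along f (cball x (e x)) T"
    using iterates_normal_onE[OF conjunct2[OF X(4)[OF x(1)]] x(2)] .
  from T(3) show False
  proof
    assume "bounded_along f (cball x (e x)) T"
    moreover have "{x} \<subseteq> cball x (e x)" using X(4)[OF x(1)] by auto
    ultimately have "bounded_along f {x} T" using bounded_along_subset by (metis order_refl)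
    moreover have "x \<in> V" using x(1) X(2) K(2) by blast
    ultimately show False using T(2) z(2) bounded_along_transfer[OF V _ z(1), of x T] by blast
  next
    assume "escapes_along f (cball x (e x)) T"
    then have "finite {n\<in>T. \<exists>w\<in>cball x (e x). norm ((f ^^ n) w) < B}" by (simp add: escapes_along_def)
    moreover have "{n\<in>T. \<exists>w\<in>cball x (e x). norm ((f ^^ n) w) < B} = T" using T(1) by (auto simp: S_def)
    ultimately show False using T(2) by simp
  qed
qed

text \<open>A bounded complementary component \<open>C\<close> need not be isolated from the others,
  so a neighbourhood of \<open>C\<close> alone could have frontier points outside \<open>U\<close>.
  The Sura-Bura theorem encloses \<open>C\<close> in a compact, relatively open part
  \<open>K\<close> of the complement, and a thin neighbourhood of \<open>K\<close> has its frontier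
  in \<open>U\<close>. A frontier point of \<open>C\<close> is one of \<open>U\<close>, hence lies
  in the Julia set.\<close>

lemma multiply_connected_hole:
  assumes U: "U \<in> Fatou_components f" and mc: "multiply_connected U"
  obtains D p where "open D" "bounded D" "connected D" "frontier D \<subseteq> U" "p \<in> D" "p \<notin> Fatou_set f"
proof -
  obtain C where C: "C \<in> components (- U)" "bounded C"
    using mc simply_connected_eq_unbounded_complement_components[OF Fatou_componentD(1)[OF U]]
      Fatou_componentD[OF U] unfolding multiply_connected_def by blast
  have cl: "closed (- U)" using Fatou_componentD(1)[OF U] by auto
  have clC: "closed C" using closed_components[OF cl C(1)] .
  have "C \<noteq> {}" using C(1) in_components_nonempty by blast
  moreover have "C \<noteq> UNIV" using C(2) not_bounded_UNIV by blast
  ultimately obtain p where p: "p \<in> frontier C" using frontier_eq_empty by blast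
  have pC: "p \<in> C" using p clC frontier_subset_closed by blast
  have "p \<in> frontier U" using p frontier_of_components_subset[OF C(1)] by (auto simp: frontier_complement)
  then have pF: "p \<notin> Fatou_set f" using frontier_Fatou_component[OF U] by blast
  have lc: "locally compact (- U)" using cl by (rule closed_imp_locally_compact)
  obtain K where K: "openin (top_of_set (- U)) K" "compact K" "C \<subseteq> K"
    using Sura_Bura_clopen_subset[OF lc C(1), of UNIV] clC C(2) by (auto simp: compact_eq_bounded_closed)
  define L where "L = (- U) - K"
  have "closedin (top_of_set (- U)) L"
    using K(1) unfolding L_def by (simp add: closedin_diff)
  then have "closed L" using cl closedin_closed_trans by blast
  then obtain d where d: "d > 0" "\<And>x y. x \<in> K \<Longrightarrow> y \<in> L \<Longrightarrow> d \<le> dist x y"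
    using separate_compact_closed[OF K(2)] unfolding L_def by (metis Diff_disjoint inf_commute)
  \<comment> \<open>The radius \<open>d / 2\<close> keeps the closure of \<open>D0\<close> away from
    \<open>L\<close>, while \<open>K\<close> lies inside the open set \<open>D0\<close>; a frontier
    point is therefore in neither.\<close>
  define D0 where "D0 = (\<Union>x\<in>K. ball x (d / 2))"
  have D0: "open D0" "K \<subseteq> D0" using d(1) by (force simp: D0_def)+
  obtain a where a: "\<And>x. x \<in> K \<Longrightarrow> norm x \<le> a"
    using compact_imp_bounded[OF K(2)] by (auto simp: bounded_iff)
  have "norm y \<le> a + d / 2" if y: "y \<in> D0" for y
  proof -
    obtain x where "x \<in> K" "y \<in> ball x (d / 2)" using y unfolding D0_def by blast
    then show ?thesis using a[of x] norm_triangle_sub[of y x] by (simp add: dist_norm norm_minus_commute)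
  qed
  then have bD0: "bounded D0" by (auto intro: boundedI)
  have fD0: "frontier D0 \<subseteq> U"
  proof
    fix w assume w: "w \<in> frontier D0"
    then have "w \<notin> D0" using D0(1) by (simp add: frontier_def interior_open)
    then have "w \<notin> K" using D0(2) by blast
    moreover have "w \<notin> L"
    proof
      assume "w \<in> L"
      have "w \<in> closure D0" using w by (simp add: frontier_def)
      then obtain y where y: "y \<in> D0" "dist y w < d / 2"
        using d(1) unfolding closure_approachable by (meson half_gt_zero)
      then obtain x where x: "x \<in> K" "y \<in> ball x (d / 2)" unfolding D0_def by blast
      then show False using d(2)[OF x(1) \<open>w \<in> L\<close>] y(2) dist_triangle[of x w y] by simp
    qed
    ultimately show "w \<in> U" by (auto simp: L_def)
  qed
  define D where "D = connected_component_set D0 p"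
  have pD: "p \<in> D" using pC K(3) D0(2) by (auto simp: D_def)
  show ?thesis
  proof (rule that[of D p])
    show "open D" unfolding D_def using D0(1) by (rule open_connected_component)
    show "bounded D" using bD0 bounded_subset connected_component_subset unfolding D_def by blast
    show "connected D" by (simp add: D_def)
    show "frontier D \<subseteq> U" using fD0 frontier_of_connected_component_subset unfolding D_def by blast
  qed (use pD pF in auto)
qed

section \<open>Images of a hole of a multiply connected component\<close>

lemma positive_real_part_Harnack:
  assumes hol: "h holomorphic_on ball 0 1" and pos: "\<And>u. norm u < 1 \<Longrightarrow> 0 < Re (h u)"
    and u: "norm u \<le> 1/2"
  shows "Re (h u) \<le> 3 * Re (h 0)" "Re (h 0) \<le> 3 * Re (h u)"
proof -
  \<comment> \<open>This Cayley transform maps the right half-plane to the unit disc and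
    \<open>h 0\<close> to 0, so Schwarz's lemma applies; at \<open>norm u \<le> 1/2\<close> it
    yields Harnack's constant \<open>3 = (1 + 1/2) / (1 - 1/2)\<close>.\<close>
  define \<phi> where "\<phi> v = (h v - h 0) / (h v + cnj (h 0))" for v
  have nz: "h v + cnj (h 0) \<noteq> 0" if "norm v < 1" for v
  proof -
    have "0 < Re (h v + cnj (h 0))" using pos[OF that] pos[of 0] by simp
    then show ?thesis by force
  qed
  have lt: "norm (\<phi> v) < 1" if "norm v < 1" for v
  proof -
    have "0 < Re (h v) * Re (h 0)" using pos[OF that] pos[of 0] by simp
    then have "(norm (h v - h 0))\<^sup>2 < (norm (h v + cnj (h 0)))\<^sup>2"
      unfolding cmod_power2 by (simp add: power2_eq_square algebra_simps)
    then have "norm (h v - h 0) < norm (h v + cnj (h 0))" by (rule power2_less_imp_less) simp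
    then show ?thesis using nz[OF that] by (simp add: \<phi>_def norm_divide)
  qed
  have "norm (\<phi> u) \<le> norm u"
  proof (rule Schwarz_Lemma(1)[of \<phi> u])
    show "\<phi> holomorphic_on ball 0 1"
      unfolding \<phi>_def by (intro holomorphic_intros hol) (use nz in auto)
  qed (use lt u in \<open>auto simp: \<phi>_def\<close>)
  then have "norm (\<phi> u) * norm (h u + cnj (h 0)) \<le> 1 / 2 * norm (h u + cnj (h 0))"
    using u by (intro mult_right_mono) auto
  then have "norm (h u - h 0) \<le> norm (h u + cnj (h 0)) / 2"
    using u nz[of u] by (simp add: \<phi>_def norm_divide)
  then have "(norm (h u - h 0))\<^sup>2 \<le> (norm (h u + cnj (h 0)) / 2)\<^sup>2" by (rule power_mono) simp
  \<comment> \<open>Thanks to the conjugate, both sides contain the same squared difference of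
    imaginary parts, with the larger factor on the left, so it can be discarded.\<close>
  then have "4 * ((Re (h u) - Re (h 0))\<^sup>2 + (Im (h u) - Im (h 0))\<^sup>2) \<le>
      (Re (h u) + Re (h 0))\<^sup>2 + (Im (h u) - Im (h 0))\<^sup>2"
    unfolding power_divide cmod_power2 by simp
  moreover have "(2 * \<bar>Re (h u) - Re (h 0)\<bar>)\<^sup>2 = 4 * (Re (h u) - Re (h 0))\<^sup>2"
    by (simp add: power_mult_distrib)
  ultimately have "(2 * \<bar>Re (h u) - Re (h 0)\<bar>)\<^sup>2 \<le> (Re (h u) + Re (h 0))\<^sup>2"
    using zero_le_power2[of "Im (h u) - Im (h 0)"] by (simp only: distrib_left)
  then have "2 * \<bar>Re (h u) - Re (h 0)\<bar> \<le> Re (h u) + Re (h 0)"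
    by (rule power2_le_imp_le) (use pos[of 0] pos[of u] u in auto)
  moreover have "a \<le> 3 * b \<and> b \<le> 3 * a" if "2 * \<bar>a - b\<bar> \<le> a + b" for a b :: real
    using that by (cases "a \<ge> b") auto
  ultimately have "Re (h u) \<le> 3 * Re (h 0) \<and> Re (h 0) \<le> 3 * Re (h u)" by blast
  then show "Re (h u) \<le> 3 * Re (h 0)" "Re (h 0) \<le> 3 * Re (h u)" by simp_all
qed

text \<open>\<open>ln (norm (g x))\<close> is the real part of a holomorphic logarithm on the disc,
  and \<open>norm (g x) > 1\<close> makes it positive.\<close>

lemma ln_norm_Harnack:
  assumes hol: "g holomorphic_on ball a \<rho>" and "0 < \<rho>" and gt: "\<And>x. x \<in> ball a \<rho> \<Longrightarrow> 1 < norm (g x)"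
    and x: "dist a x \<le> \<rho> / 2"
  shows "ln (norm (g x)) \<le> 3 * ln (norm (g a))" "ln (norm (g a)) \<le> 3 * ln (norm (g x))"
proof -
  have inb: "a + of_real \<rho> * v \<in> ball a \<rho>" if "norm v < 1" for v :: complex
    using that \<open>0 < \<rho>\<close> by (simp add: dist_norm norm_mult)
  define G where "G v = g (a + of_real \<rho> * v)" for v
  have "(g \<circ> (\<lambda>v. a + of_real \<rho> * v)) holomorphic_on ball 0 1"
    by (rule holomorphic_on_compose_gen[OF _ hol]) (use inb in \<open>auto intro!: holomorphic_intros\<close>)
  then have "G holomorphic_on ball 0 1" by (simp add: G_def[abs_def] o_def)
  moreover have G: "1 < norm (G v)" if "norm v < 1" for v using gt[OF inb[OF that]] by (simp add: G_def)
  then have "\<And>v. v \<in> ball 0 1 \<Longrightarrow> G v \<noteq> 0" by force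
  ultimately obtain h where h: "h holomorphic_on ball 0 1" "\<And>v. v \<in> ball 0 1 \<Longrightarrow> G v = exp (h v)"
    using contractible_imp_holomorphic_log[of G "ball 0 1"] convex_imp_contractible[of "ball (0::complex) 1"]
    by (metis convex_ball)
  have Re: "Re (h v) = ln (norm (G v))" if "norm v < 1" for v using h(2)[of v] that by (simp add: norm_exp_eq_Re)
  have pos: "0 < Re (h v)" if "norm v < 1" for v using Re[OF that] ln_gt_zero[OF G[OF that]] by simp
  define u where "u = (x - a) / of_real \<rho>"
  have "norm u = dist a x / \<rho>"
    using \<open>0 < \<rho>\<close> by (simp add: u_def norm_divide dist_norm norm_minus_commute)
  then have u: "norm u \<le> 1/2" using divide_right_mono[OF x, of \<rho>] \<open>0 < \<rho>\<close> by simp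
  have "G u = g x" "G 0 = g a" using \<open>0 < \<rho>\<close> by (auto simp: G_def u_def)
  then show "ln (norm (g x)) \<le> 3 * ln (norm (g a))" "ln (norm (g a)) \<le> 3 * ln (norm (g x))"
    using positive_real_part_Harnack[OF h(1) pos u] Re[of u] Re[of 0] u by auto
qed

text \<open>Equivalent to \<open>norm ((f ^^ n) z)\<close> tending to infinity; this form lets
  boundedness along index sets be transferred directly.\<close>

definition escaping :: "(complex \<Rightarrow> complex) \<Rightarrow> complex \<Rightarrow> bool" where
  "escaping f z \<longleftrightarrow> (\<forall>S. infinite S \<longrightarrow> \<not> bounded_along f {z} S)"

lemma escaping_locally_uniform:
  assumes V: "V \<in> Fatou_components f" and z: "z \<in> V" "escaping f z" and K: "compact K" "K \<subseteq> V"
  shows "\<forall>\<^sub>F n in sequentially. \<forall>w\<in>K. B \<le> norm ((f ^^ n) w)"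
  using iterates_exceed_on_compact[OF V K z(1)] z(2) by (simp add: escaping_def eventually_sequentially)

lemma escaping_funpow:
  assumes "escaping f z"
  shows "escaping f ((f ^^ j) z)"
  unfolding escaping_def
proof (intro allI impI notI)
  fix S :: "nat set" assume S: "infinite S" "bounded_along f {(f ^^ j) z} S"
  obtain B where "\<And>n. n \<in> S \<Longrightarrow> norm ((f ^^ n) ((f ^^ j) z)) \<le> B"
    using S(2) unfolding bounded_along_def by blast
  then have "bounded_along f {z} ((\<lambda>n. n + j) ` S)"
    unfolding bounded_along_def by (intro exI[of _ B]) (simp add: funpow_add)
  moreover have "infinite ((\<lambda>n. n + j) ` S)" using S(1) by (simp add: finite_image_iff)
  ultimately show False using assms unfolding escaping_def by blast
qed

lemma Harnack_local:
  assumes hol: "f holomorphic_on UNIV" and V: "V \<in> Fatou_components f"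
    and z: "z \<in> V" "escaping f z" and a: "a \<in> V"
  shows "\<exists>e>0. \<forall>\<^sub>F n in sequentially. \<forall>x\<in>ball a e. 1 < norm ((f ^^ n) x) \<and>
    ln (norm ((f ^^ n) x)) \<le> 3 * ln (norm ((f ^^ n) a)) \<and>
    ln (norm ((f ^^ n) a)) \<le> 3 * ln (norm ((f ^^ n) x))"
proof -
  obtain e where e: "e > 0" "cball a e \<subseteq> V"
    using Fatou_componentD(1)[OF V] a open_contains_cball by blast
  have "\<forall>\<^sub>F n in sequentially. \<forall>w\<in>cball a e. 2 \<le> norm ((f ^^ n) w)"
    by (rule escaping_locally_uniform[OF V z _ e(2)]) simp
  then have "\<forall>\<^sub>F n in sequentially. \<forall>x\<in>ball a (e / 2). 1 < norm ((f ^^ n) x) \<and>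
    ln (norm ((f ^^ n) x)) \<le> 3 * ln (norm ((f ^^ n) a)) \<and>
    ln (norm ((f ^^ n) a)) \<le> 3 * ln (norm ((f ^^ n) x))"
  proof (rule eventually_mono)
    fix n assume n: "\<forall>w\<in>cball a e. 2 \<le> norm ((f ^^ n) w)"
    have gt: "1 < norm ((f ^^ n) x)" if "x \<in> ball a e" for x
    proof -
      have "2 \<le> norm ((f ^^ n) x)" using n that by simp
      then show ?thesis by simp
    qed
    have hol': "(f ^^ n) holomorphic_on ball a e"
      using holomorphic_funpow[OF hol] holomorphic_on_subset by blast
    show "\<forall>x\<in>ball a (e / 2). 1 < norm ((f ^^ n) x) \<and>
        ln (norm ((f ^^ n) x)) \<le> 3 * ln (norm ((f ^^ n) a)) \<and>
        ln (norm ((f ^^ n) a)) \<le> 3 * ln (norm ((f ^^ n) x))"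
    proof
      fix x assume "x \<in> ball a (e / 2)"
      then have x: "dist a x \<le> e / 2" "x \<in> ball a e" using e(1) by auto
      show "1 < norm ((f ^^ n) x) \<and>
        ln (norm ((f ^^ n) x)) \<le> 3 * ln (norm ((f ^^ n) a)) \<and>
        ln (norm ((f ^^ n) a)) \<le> 3 * ln (norm ((f ^^ n) x))"
        using gt[OF x(2)] ln_norm_Harnack[OF hol' e(1) gt x(1)] by blast
    qed
  qed
  then show ?thesis using e(1) by (intro exI[of _ "e / 2"]) auto
qed

text \<open>Harnack constants multiply along chains of discs, so eventual comparability with some
  constant is a transitive relation that holds locally, and connectedness of \<open>V\<close> does
  the rest.\<close>

lemma Harnack_pair:
  assumes hol: "f holomorphic_on UNIV" and V: "V \<in> Fatou_components f"
    and z: "z \<in> V" "escaping f z" and w: "w \<in> V"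
  shows "\<exists>C\<ge>0. \<forall>\<^sub>F n in sequentially. ln (norm ((f ^^ n) w)) \<le> C * ln (norm ((f ^^ n) z)) \<and>
    ln (norm ((f ^^ n) z)) \<le> C * ln (norm ((f ^^ n) w))"
proof -
  define R where "R z w \<longleftrightarrow> (\<exists>C\<ge>0. \<forall>\<^sub>F n in sequentially. ln (norm ((f ^^ n) w)) \<le> C * ln (norm ((f ^^ n) z)) \<and>
    ln (norm ((f ^^ n) z)) \<le> C * ln (norm ((f ^^ n) w)))" for z w
  have "R z w"
  proof (rule connected_equivalence_relation[OF Fatou_componentD(2)[OF V] z(1) w])
    show "R y x" if "R x y" for x y using that unfolding R_def by (simp add: conj_commute)
    show "R x u" if R: "R x y" "R y u" for x y u
    proof -
      obtain C where C: "C \<ge> 0" "\<forall>\<^sub>F n in sequentially. ln (norm ((f ^^ n) y)) \<le> C * ln (norm ((f ^^ n) x)) \<and>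
        ln (norm ((f ^^ n) x)) \<le> C * ln (norm ((f ^^ n) y))" using R(1) unfolding R_def by blast
      obtain C' where C': "C' \<ge> 0" "\<forall>\<^sub>F n in sequentially. ln (norm ((f ^^ n) u)) \<le> C' * ln (norm ((f ^^ n) y)) \<and>
        ln (norm ((f ^^ n) y)) \<le> C' * ln (norm ((f ^^ n) u))" using R(2) unfolding R_def by blast
      have "\<forall>\<^sub>F n in sequentially. ln (norm ((f ^^ n) u)) \<le> (C * C') * ln (norm ((f ^^ n) x)) \<and>
        ln (norm ((f ^^ n) x)) \<le> (C * C') * ln (norm ((f ^^ n) u))"
        using C(2) C'(2)
      proof eventually_elim
        case (elim n)
        then show ?case
          using mult_left_mono[of "ln (norm ((f ^^ n) y))" "C * ln (norm ((f ^^ n) x))" C']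
            mult_left_mono[of "ln (norm ((f ^^ n) y))" "C' * ln (norm ((f ^^ n) u))" C] C(1) C'(1)
          by (auto simp: algebra_simps)
      qed
      then show ?thesis using C(1) C'(1) unfolding R_def by (intro exI[of _ "C * C'"]) auto
    qed
    fix a assume a: "a \<in> V"
    obtain e where e: "e > 0" "\<forall>\<^sub>F n in sequentially. \<forall>x\<in>ball a e. 1 < norm ((f ^^ n) x) \<and>
      ln (norm ((f ^^ n) x)) \<le> 3 * ln (norm ((f ^^ n) a)) \<and>
      ln (norm ((f ^^ n) a)) \<le> 3 * ln (norm ((f ^^ n) x))"
      using Harnack_local[OF hol V z a] by blast
    have "R a x" if "x \<in> ball a e" for x
      unfolding R_def using that by (intro exI[of _ 3] conjI eventually_mono[OF e(2)]) auto
    then show "\<exists>T. openin (top_of_set V) T \<and> a \<in> T \<and> (\<forall>x\<in>T. R a x)"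
      using a e(1) by (intro exI[of _ "V \<inter> ball a e"]) auto
  qed
  then show ?thesis by (simp add: R_def)
qed

lemma Harnack_compact:
  assumes hol: "f holomorphic_on UNIV" and V: "V \<in> Fatou_components f"
    and z: "z \<in> V" "escaping f z" and K: "compact K" "K \<subseteq> V"
  shows "\<exists>C>0. \<forall>\<^sub>F n in sequentially. \<forall>x\<in>K. \<forall>y\<in>K.
    1 < norm ((f ^^ n) x) \<and> ln (norm ((f ^^ n) x)) \<le> C * ln (norm ((f ^^ n) y))"
proof -
  define L where "L n x = ln (norm ((f ^^ n) x))" for n x
  have "\<forall>a\<in>V. \<exists>e>0. \<forall>\<^sub>F n in sequentially. \<forall>x\<in>ball a e. 1 < norm ((f ^^ n) x) \<and>
      L n x \<le> 3 * L n a \<and> L n a \<le> 3 * L n x"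
    using Harnack_local[OF hol V z] by (simp add: L_def)
  from bchoice[OF this] obtain e where e: "\<And>a. a \<in> V \<Longrightarrow> e a > 0"
    "\<And>a. a \<in> V \<Longrightarrow> \<forall>\<^sub>F n in sequentially. \<forall>x\<in>ball a (e a). 1 < norm ((f ^^ n) x) \<and>
      L n x \<le> 3 * L n a \<and> L n a \<le> 3 * L n x" by blast
  have "\<forall>a\<in>V. \<exists>C\<ge>0. \<forall>\<^sub>F n in sequentially. L n a \<le> C * L n z \<and> L n z \<le> C * L n a"
    using Harnack_pair[OF hol V z] by (simp add: L_def)
  from bchoice[OF this] obtain C where C: "\<And>a. a \<in> V \<Longrightarrow> C a \<ge> 0"
    "\<And>a. a \<in> V \<Longrightarrow> \<forall>\<^sub>F n in sequentially. L n a \<le> C a * L n z \<and> L n z \<le> C a * L n a" by blast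
  have "K \<subseteq> (\<Union>a\<in>K. ball a (e a))" using e(1) K(2) by force
  then obtain X where X: "X \<subseteq> K" "finite X" "K \<subseteq> (\<Union>a\<in>X. ball a (e a))"
    using compactE_image[OF K(1), of K "\<lambda>a. ball a (e a)"] by (metis open_ball)
  \<comment> \<open>One constant dominating the finitely many \<open>C a\<close>. A point is
    compared with its disc centre (factor 3) and the centre with \<open>z\<close> (factor
    \<open>c\<close>), so passing from \<open>x\<close> through \<open>z\<close> to \<open>y\<close>
    costs \<open>9 * c * c\<close>.\<close>
  define c where "c = (\<Sum>a\<in>X. C a) + 1"
  have XV: "a \<in> V" if "a \<in> X" for a using that X(1) K(2) by blast
  have Cc: "C a \<le> c" if "a \<in> X" for a
    using member_le_sum[of a X C] that X(2) C(1) XV by (force simp: c_def)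
  have c: "c > 0" using sum_nonneg[of X C] C(1) XV by (force simp: c_def)
  have ev: "\<forall>\<^sub>F n in sequentially. \<forall>a\<in>X. (\<forall>x\<in>ball a (e a). 1 < norm ((f ^^ n) x) \<and>
      L n x \<le> 3 * L n a \<and> L n a \<le> 3 * L n x) \<and> L n a \<le> C a * L n z \<and> L n z \<le> C a * L n a"
    using eventually_conj[OF e(2)[OF XV] C(2)[OF XV]] by (intro eventually_ball_finite X(2) ballI) blast
  have evz: "\<forall>\<^sub>F n in sequentially. \<forall>w\<in>{z}. 1 \<le> norm ((f ^^ n) w)"
    by (rule escaping_locally_uniform[OF V z]) (use z in auto)
  have "\<forall>\<^sub>F n in sequentially. \<forall>x\<in>K. \<forall>y\<in>K. 1 < norm ((f ^^ n) x) \<and> L n x \<le> (9 * c * c) * L n y"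
    using ev evz
  proof eventually_elim
    case (elim n)
    have z0: "0 \<le> L n z" using elim(2) by (simp add: L_def ln_ge_zero)
    have *: "1 < norm ((f ^^ n) x) \<and> L n x \<le> 3 * c * L n z \<and> L n z \<le> 3 * c * L n x" if x: "x \<in> K" for x
    proof -
      obtain a where a: "a \<in> X" "x \<in> ball a (e a)" using X(3) x by blast
      have 1: "1 < norm ((f ^^ n) x)" "L n x \<le> 3 * L n a" "L n a \<le> 3 * L n x"
        "L n a \<le> C a * L n z" "L n z \<le> C a * L n a" using elim(1) a by auto
      have x0: "0 \<le> L n x" using 1(1) by (simp add: L_def ln_ge_zero)
      then have a0: "0 \<le> L n a" using 1(2) by simp
      have "C a * L n z \<le> c * L n z" "C a * L n a \<le> c * L n a"
        using Cc[OF a(1)] z0 a0 by (auto intro: mult_right_mono)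
      moreover have "c * L n a \<le> c * (3 * L n x)" using c 1(3) by (intro mult_left_mono) auto
      ultimately show ?thesis using 1 by (auto simp: algebra_simps)
    qed
    show ?case
    proof (intro ballI conjI)
      fix x y assume xy: "x \<in> K" "y \<in> K"
      show "1 < norm ((f ^^ n) x)" using * xy by blast
      have "L n x \<le> 3 * c * L n z" using * xy by blast
      also have "\<dots> \<le> 3 * c * (3 * c * L n y)" using * xy c by (intro mult_left_mono) auto
      finally show "L n x \<le> (9 * c * c) * L n y" by (simp add: algebra_simps)
    qed
  qed
  then show ?thesis using c unfolding L_def by (intro exI[of _ "9 * c * c"]) auto
qed

lemma frontier_image_subset:
  fixes g :: "complex \<Rightarrow> complex"
  assumes "continuous_on (closure D) g" "bounded D" "open (g ` D)"
  shows "frontier (g ` D) \<subseteq> g ` frontier D"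
proof
  fix w assume w: "w \<in> frontier (g ` D)"
  have "compact (g ` closure D)"
    using assms by (intro compact_continuous_image) (auto simp: bounded_closure compact_eq_bounded_closed)
  then have "closed (g ` closure D)" by (rule compact_imp_closed)
  then have "closure (g ` D) \<subseteq> g ` closure D"
    using closure_subset by (intro closure_minimal) auto
  moreover have "w \<in> closure (g ` D)" "w \<notin> g ` D"
    using w assms(3) by (auto simp: frontier_def interior_open)
  ultimately show "w \<in> g ` frontier D" using interior_subset by (fastforce simp: frontier_def)
qed

text \<open>Multiple connectedness of \<open>U\<close> enters only through the existence of such
  \<open>D\<close> and \<open>p\<close>; the point \<open>p\<close> of the Julia set is what rules
  out normality on \<open>D\<close>.\<close>

locale Fatou_hole =
  fixes f :: "complex \<Rightarrow> complex" and U D :: "complex set" and p :: complex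
  assumes transc: "transcendental_entire f"
    and U: "U \<in> Fatou_components f"
    and D: "open D" "bounded D" "connected D" "frontier D \<subseteq> U"
    and p: "p \<in> D" "p \<notin> Fatou_set f"
begin

lemma hol: "f holomorphic_on UNIV"
  using transc by (simp add: transcendental_entire_def)

lemma hol_funpow: "(f ^^ n) holomorphic_on S"
  using holomorphic_funpow[OF hol] holomorphic_on_subset by blast

lemma cont_funpow: "continuous_on S (f ^^ n)"
  using hol_funpow by (rule holomorphic_on_imp_continuous_on)

lemma compact_frontier: "compact (frontier D)"
  using D(2) by (rule compact_frontier_bounded)

lemma frontier_nonempty: "frontier D \<noteq> {}"
  using p(1) D(2) not_bounded_UNIV frontier_eq_empty by blast

lemma D_meets_U: "D \<inter> U \<noteq> {}"
proof -
  obtain q where q: "q \<in> frontier D" using frontier_nonempty by blast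
  then have "q \<in> closure D \<inter> U" using D(4) by (auto simp: frontier_def)
  then show ?thesis using Fatou_componentD(1)[OF U] open_Int_closure_eq_empty[of U D] by blast
qed

lemma max_modulus_hole:
  assumes "\<And>w. w \<in> frontier D \<Longrightarrow> norm ((f ^^ n) w) \<le> B" "w \<in> D"
  shows "norm ((f ^^ n) w) \<le> B"
  by (rule maximum_modulus_frontier[of "f ^^ n" D]) (use assms D hol_funpow cont_funpow in auto)

text \<open>Otherwise every image of \<open>D\<close> misses a point of the circle of radius
  \<open>\<rho>\<close> and one of the circle of radius \<open>2 * \<rho>\<close>. The missed points
  vary with the iterate, but Schottky's bound depends only on the radii, so the iterates would be
  normal at \<open>p\<close>.\<close>

lemma covers_circle_from_hole:
  assumes "1 \<le> \<rho>"
  obtains m s where "\<rho> \<le> s" "sphere 0 s \<subseteq> (f ^^ m) ` D"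
proof (rule ccontr)
  assume "\<not> thesis"
  then have neg: "\<And>m s. \<rho> \<le> s \<Longrightarrow> \<not> sphere 0 s \<subseteq> (f ^^ m) ` D" using that by blast
  obtain e where e: "e > 0" "ball p e \<subseteq> D" using D(1) p(1) open_contains_ball by blast
  define \<Phi> where "\<Phi> B = \<rho> * (1 + 3 * exp (pi * exp (pi * (2 + 2 * ((B + \<rho>) / \<rho>) + 12))))" for B
  have Sch: "norm ((f ^^ n) y) \<le> \<Phi> B"
    if n: "norm ((f ^^ n) x) \<le> B" "dist x y \<le> s / 3" "0 < s" "ball x s \<subseteq> ball p e" for n x y s B
  proof -
    have "\<not> sphere 0 \<rho> \<subseteq> (f ^^ n) ` D" "\<not> sphere 0 (2 * \<rho>) \<subseteq> (f ^^ n) ` D" using neg assms by auto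
    then obtain w1 w2 where w: "norm w1 = \<rho>" "norm w2 = 2 * \<rho>" "w1 \<notin> (f ^^ n) ` D" "w2 \<notin> (f ^^ n) ` D"
      by (auto simp: subset_iff)
    have sub: "ball x s \<subseteq> D" using n(4) e(2) by blast
    show ?thesis unfolding \<Phi>_def
      by (rule Schottky_disc[of "f ^^ n" x s \<rho> w1 w2]) (use w n assms sub hol_funpow in auto)
  qed
  \<comment> \<open>Schottky's bound is used twice, from a point \<open>w\<close> of the small disc
    to \<open>p\<close> and from \<open>p\<close> to \<open>y\<close>. The radius
    \<open>e / 6\<close> is a third of \<open>e / 2\<close>, and the disc of radius
    \<open>e / 2\<close> about \<open>w\<close> still lies in \<open>ball p e\<close>.\<close>
  have "iterates_normal_on f (cball p (e / 6))" unfolding iterates_normal_on_def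
  proof (intro allI impI)
    fix S :: "nat set" assume S: "infinite S"
    show "\<exists>T\<subseteq>S. infinite T \<and> (bounded_along f (cball p (e / 6)) T \<or> escapes_along f (cball p (e / 6)) T)"
    proof (cases "escapes_along f (cball p (e / 6)) S")
      case True
      then show ?thesis using S by blast
    next
      case False
      then obtain B where B: "infinite {n\<in>S. \<exists>w\<in>cball p (e / 6). norm ((f ^^ n) w) < B}"
        unfolding escapes_along_def by blast
      let ?T = "{n\<in>S. \<exists>w\<in>cball p (e / 6). norm ((f ^^ n) w) < B}"
      have "norm ((f ^^ n) y) \<le> \<Phi> (\<Phi> B)" if n: "n \<in> ?T" and y: "y \<in> cball p (e / 6)" for n y
      proof -
        obtain w where w: "w \<in> cball p (e / 6)" "norm ((f ^^ n) w) < B" using n by blast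
        have "norm ((f ^^ n) p) \<le> \<Phi> B"
        proof (rule Sch[of n w B p "e / 2"])
          show "ball w (e / 2) \<subseteq> ball p e"
          proof
            fix v assume "v \<in> ball w (e / 2)"
            then show "v \<in> ball p e" using w(1) e(1) dist_triangle[of p v w] by simp
          qed
        qed (use w e(1) in \<open>auto simp: dist_commute\<close>)
        then show ?thesis by (rule Sch[of n p "\<Phi> B" y e]) (use y e(1) in auto)
      qed
      then have "bounded_along f (cball p (e / 6)) ?T" unfolding bounded_along_def by blast
      then show ?thesis using B by (intro exI[of _ ?T]) auto
    qed
  qed
  then show False using Fatou_setI[OF hol, of "e / 6" p] e(1) p(2) by simp
qed

lemma escaping_U:
  assumes "z \<in> U"
  shows "escaping f z"
  unfolding escaping_def
proof (intro allI impI notI)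
  fix S :: "nat set" assume S: "infinite S" "bounded_along f {z} S"
  obtain T where T: "T \<subseteq> S" "infinite T" "bounded_along f (frontier D) T"
    using bounded_along_compact[OF U compact_frontier D(4) assms S] .
  then obtain B where B: "\<And>n w. n \<in> T \<Longrightarrow> w \<in> frontier D \<Longrightarrow> norm ((f ^^ n) w) \<le> B"
    unfolding bounded_along_def by blast
  obtain \<rho> where \<rho>: "\<rho> \<ge> 1" "\<And>s k. s \<ge> \<rho> \<Longrightarrow> 2 ^ k * s \<le> max_modulus s (f ^^ k)"
    using max_modulus_funpow_ge[OF transc] by blast
  obtain m s where ms: "\<rho> \<le> s" "sphere 0 s \<subseteq> (f ^^ m) ` D" using covers_circle_from_hole[OF \<rho>(1)] .
  obtain k where k: "B < 2 ^ k" using real_arch_pow[of 2 B] by auto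
  \<comment> \<open>The first \<open>m\<close> iterations carry some \<open>v\<close> in
    \<open>D\<close> to the point of the circle where the remaining iterate is largest; the
    remaining \<open>n - m \<ge> k\<close> iterations push it beyond \<open>B\<close>.\<close>
  obtain n where n: "n \<in> T" "n \<ge> k + m" using T(2) unfolding infinite_nat_iff_unbounded_le by blast
  obtain w where w: "norm w = s" "norm ((f ^^ (n - m)) w) = max_modulus s (f ^^ (n - m))"
    using max_modulus_attained[OF holomorphic_funpow[OF hol], of s] ms(1) \<rho>(1) by auto
  obtain v where v: "v \<in> D" "w = (f ^^ m) v" using ms(2) w(1) by (auto simp: subset_iff)
  have "(f ^^ n) v = (f ^^ (n - m)) w" using n(2) v(2) funpow_add[of "n - m" m f] by simp
  then have "2 ^ (n - m) * s \<le> norm ((f ^^ n) v)" using \<rho>(2)[OF ms(1)] w(2) by simp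
  moreover have "norm ((f ^^ n) v) \<le> B" using max_modulus_hole[OF B[OF n(1)] v(1)] .
  moreover have "2 ^ k * 1 \<le> 2 ^ (n - m) * s"
    using n(2) ms(1) \<rho>(1) by (intro mult_mono power_increasing) auto
  ultimately show False using k by simp
qed

section \<open>Discs covered by the images of the hole, and components enclosed by them\<close>

definition rmin :: "nat \<Rightarrow> real" where "rmin n = (INF w\<in>frontier D. norm ((f ^^ n) w))"
definition rmax :: "nat \<Rightarrow> real" where "rmax n = (SUP w\<in>frontier D. norm ((f ^^ n) w))"

lemma rmin_attained: "\<exists>w\<in>frontier D. norm ((f ^^ n) w) = rmin n"
  and rmin_le: "w \<in> frontier D \<Longrightarrow> rmin n \<le> norm ((f ^^ n) w)"
proof -
  have "continuous_on (frontier D) (\<lambda>w. norm ((f ^^ n) w))" by (intro continuous_on_norm cont_funpow)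
  then obtain x where x: "x \<in> frontier D" "\<And>w. w \<in> frontier D \<Longrightarrow> norm ((f ^^ n) x) \<le> norm ((f ^^ n) w)"
    using continuous_attains_inf[OF compact_frontier frontier_nonempty] by metis
  have "rmin n = norm ((f ^^ n) x)" unfolding rmin_def using x by (intro cInf_eq_minimum) auto
  then show "\<exists>w\<in>frontier D. norm ((f ^^ n) w) = rmin n"
    "w \<in> frontier D \<Longrightarrow> rmin n \<le> norm ((f ^^ n) w)" using x by auto
qed

lemma rmax_attained: "\<exists>w\<in>frontier D. norm ((f ^^ n) w) = rmax n"
  and rmax_ge: "w \<in> frontier D \<Longrightarrow> norm ((f ^^ n) w) \<le> rmax n"
proof -
  have "continuous_on (frontier D) (\<lambda>w. norm ((f ^^ n) w))" by (intro continuous_on_norm cont_funpow)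
  then obtain x where x: "x \<in> frontier D" "\<And>w. w \<in> frontier D \<Longrightarrow> norm ((f ^^ n) w) \<le> norm ((f ^^ n) x)"
    using continuous_attains_sup[OF compact_frontier frontier_nonempty] by metis
  have "rmax n = norm ((f ^^ n) x)" unfolding rmax_def using x by (intro cSup_eq_maximum) auto
  then show "\<exists>w\<in>frontier D. norm ((f ^^ n) w) = rmax n"
    "w \<in> frontier D \<Longrightarrow> norm ((f ^^ n) w) \<le> rmax n" using x by auto
qed

lemma rmax_ge_hole: "w \<in> D \<Longrightarrow> norm ((f ^^ n) w) \<le> rmax n"
  using max_modulus_hole rmax_ge by blast

lemma rmin_le_rmax: "rmin n \<le> rmax n"
  using rmin_attained rmax_ge by metis

lemma rmin_at_top: "\<forall>\<^sub>F n in sequentially. B \<le> rmin n"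
proof -
  obtain z where z: "z \<in> U" using Fatou_componentD(3)[OF U] by blast
  have "\<forall>\<^sub>F n in sequentially. \<forall>w\<in>frontier D. B \<le> norm ((f ^^ n) w)"
    by (rule escaping_locally_uniform[OF U z escaping_U[OF z] compact_frontier D(4)])
  then show ?thesis by (rule eventually_mono) (use rmin_attained in metis)
qed

lemma rmax_le_rmin_powr: "\<exists>C>0. \<forall>\<^sub>F n in sequentially. 1 < rmin n \<and> rmax n \<le> rmin n powr C"
proof -
  obtain z where z: "z \<in> U" using Fatou_componentD(3)[OF U] by blast
  obtain C where C: "C > 0" "\<forall>\<^sub>F n in sequentially. \<forall>x\<in>frontier D. \<forall>y\<in>frontier D.
    1 < norm ((f ^^ n) x) \<and> ln (norm ((f ^^ n) x)) \<le> C * ln (norm ((f ^^ n) y))"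
    using Harnack_compact[OF hol U z escaping_U[OF z] compact_frontier D(4)] by blast
  have "\<forall>\<^sub>F n in sequentially. 1 < rmin n \<and> rmax n \<le> rmin n powr C"
    using C(2)
  proof (rule eventually_mono)
    fix n assume n: "\<forall>x\<in>frontier D. \<forall>y\<in>frontier D.
      1 < norm ((f ^^ n) x) \<and> ln (norm ((f ^^ n) x)) \<le> C * ln (norm ((f ^^ n) y))"
    obtain x y where x: "x \<in> frontier D" "norm ((f ^^ n) x) = rmax n"
      and y: "y \<in> frontier D" "norm ((f ^^ n) y) = rmin n" using rmin_attained rmax_attained by metis
    have 1: "1 < rmin n" "1 < rmax n" "ln (rmax n) \<le> C * ln (rmin n)" using n x y by metis+
    have "rmax n = exp (ln (rmax n))" using 1(2) by simp
    also have "\<dots> \<le> exp (C * ln (rmin n))" using 1(3) by (simp only: exp_le_cancel_iff)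
    finally show "1 < rmin n \<and> rmax n \<le> rmin n powr C" using 1 by (simp add: powr_def)
  qed
  then show ?thesis using C(1) by blast
qed

lemma open_image_hole: "open ((f ^^ n) ` D)"
  using open_image_funpow[OF transc D(1)] .

lemma frontier_image_hole: "frontier ((f ^^ n) ` D) \<subseteq> (f ^^ n) ` frontier D"
  using frontier_image_subset[OF cont_funpow D(2) open_image_hole] .

text \<open>A disc that meets the image without lying in it would, being connected, meet its
  frontier, whose points have norm at least \<open>rmin n\<close>.\<close>

lemma ball_subset_image_hole:
  assumes "(f ^^ n) ` D \<inter> ball 0 (rmin n) \<noteq> {}"
  shows "ball 0 (rmin n) \<subseteq> (f ^^ n) ` D"
proof (rule ccontr)
  assume "\<not> ?thesis"
  then have "ball 0 (rmin n) \<inter> frontier ((f ^^ n) ` D) \<noteq> {}"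
    using assms by (intro connected_Int_frontier) auto
  then obtain w where "w \<in> frontier D" "norm ((f ^^ n) w) < rmin n" using frontier_image_hole by fastforce
  then show False using rmin_le[of w n] by simp
qed

text \<open>Once an image of the hole covers its disc, it contains \<open>0\<close>, so the next one contains \<open>f 0\<close>
  and covers its disc as well. If no image ever did, the iterates would escape uniformly
  on the hole, which meets the Julia set.\<close>
lemma eventually_ball_subset_image: "\<forall>\<^sub>F n in sequentially. ball 0 (rmin n) \<subseteq> (f ^^ n) ` D"
proof -
  obtain n1 where n1: "\<And>n. n \<ge> n1 \<Longrightarrow> norm (f 0) + 1 \<le> rmin n"
    using rmin_at_top[of "norm (f 0) + 1"] by (auto simp: eventually_sequentially)
  have "\<exists>m\<ge>n1. (f ^^ m) ` D \<inter> ball 0 (rmin m) \<noteq> {}"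
  proof (rule ccontr)
    assume neg: "\<not> ?thesis"
    have ge: "rmin n \<le> norm ((f ^^ n) w)" if "n \<ge> n1" "w \<in> D" for n w
    proof (rule ccontr)
      assume "\<not> ?thesis"
      then have "(f ^^ n) w \<in> (f ^^ n) ` D \<inter> ball 0 (rmin n)" using that by simp
      then show False using neg that(1) by blast
    qed
    obtain e where e: "e > 0" "cball p e \<subseteq> D" using D(1) p(1) open_contains_cball by blast
    have "escapes_along f (cball p e) S" for S
      unfolding escapes_along_def
    proof
      fix B
      obtain N where N: "\<And>n. n \<ge> N \<Longrightarrow> B \<le> rmin n"
        using rmin_at_top[of B] by (auto simp: eventually_sequentially)
      have "n < max N n1" if n: "\<exists>w\<in>cball p e. norm ((f ^^ n) w) < B" for n
      proof (rule ccontr)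
        assume "\<not> ?thesis"
        then have "N \<le> n" "n1 \<le> n" by auto
        then show False using n ge[of n] N[of n] e(2) by fastforce
      qed
      then have "{n\<in>S. \<exists>w\<in>cball p e. norm ((f ^^ n) w) < B} \<subseteq> {..<max N n1}" by blast
      then show "finite {n\<in>S. \<exists>w\<in>cball p e. norm ((f ^^ n) w) < B}" by (rule finite_subset) simp
    qed
    then have "iterates_normal_on f (cball p e)" unfolding iterates_normal_on_def by blast
    then show False using Fatou_setI[OF hol e(1)] p(2) by blast
  qed
  then obtain m where m: "m \<ge> n1" "(f ^^ m) ` D \<inter> ball 0 (rmin m) \<noteq> {}" by blast
  have "ball 0 (rmin n) \<subseteq> (f ^^ n) ` D" if "n \<ge> m" for n
    using that
  proof (induction n rule: dec_induct)
    case base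
    show ?case by (rule ball_subset_image_hole[OF m(2)])
  next
    case (step n)
    have "0 < rmin n" using n1[of n] step m(1) norm_ge_zero[of "f 0"] by linarith
    then have "0 \<in> (f ^^ n) ` D" using step by auto
    then have "f 0 \<in> (f ^^ Suc n) ` D" by force
    moreover have "f 0 \<in> ball 0 (rmin (Suc n))" using n1[of "Suc n"] step m(1) by simp
    ultimately show ?case using ball_subset_image_hole by blast
  qed
  then show ?thesis by (auto simp: eventually_sequentially)
qed

text \<open>If \<open>V\<close> leaves the image of \<open>D\<close>, it meets its frontier, which
  comes from points of \<open>U\<close>; then the whole image of \<open>U\<close> lies in
  \<open>V\<close>. All later size estimates rest on this alternative.\<close>

lemma component_subset_image_or_contains:
  assumes V: "V \<in> Fatou_components f" and cov: "ball 0 (rmin n) \<subseteq> (f ^^ n) ` D"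
    and v: "v \<in> V" "norm v < rmin n"
  shows "V \<subseteq> (f ^^ n) ` D \<or> (f ^^ n) ` U \<subseteq> V"
proof (rule disjCI)
  assume "\<not> (f ^^ n) ` U \<subseteq> V"
  show "V \<subseteq> (f ^^ n) ` D"
  proof (rule ccontr)
    assume "\<not> ?thesis"
    moreover have "v \<in> (f ^^ n) ` D" using cov v(2) by (auto simp: subset_iff)
    ultimately have "V \<inter> frontier ((f ^^ n) ` D) \<noteq> {}"
      using v(1) Fatou_componentD(2)[OF V] by (intro connected_Int_frontier) auto
    then obtain w where w: "w \<in> frontier D" "(f ^^ n) w \<in> V" using frontier_image_hole[of n] by blast
    then have "(f ^^ n) ` U \<subseteq> V"
      using image_funpow_subset_component[OF transc U V] D(4) by blast
    then show False using \<open>\<not> (f ^^ n) ` U \<subseteq> V\<close> by blast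
  qed
qed

lemma bounded_image_hole: "bounded ((f ^^ n) ` D)"
  using rmax_ge_hole by (auto simp: bounded_iff)

text \<open>Otherwise all large images of \<open>U\<close> lie in one unbounded component, and Harnack's inequality
  there bounds \<open>|f w|\<close> by a power of \<open>|w|\<close> on frontiers receding to \<open>\<infinity>\<close>.\<close>
lemma component_contains_at_most_one_image:
  assumes V: "V \<in> Fatou_components f" and nm: "n < m" "(f ^^ n) ` U \<subseteq> V" "(f ^^ m) ` U \<subseteq> V"
  shows False
proof (cases "bounded V")
  case True
  obtain u where u: "u \<in> U" using Fatou_componentD(3)[OF U] by blast
  \<comment> \<open>A bounded \<open>V\<close> mapped into itself by \<open>f ^^ (m - n)\<close>
    keeps the orbit of \<open>u\<close> bounded along an arithmetic progression of indices, which
    contradicts escape.\<close>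
  have inv: "(f ^^ (m - n)) ` V \<subseteq> V"
  proof (rule image_funpow_subset_component[OF transc V V])
    show "(f ^^ n) u \<in> V" using nm(2) u by blast
    have "(f ^^ (m - n)) ((f ^^ n) u) = (f ^^ m) u" using nm(1) funpow_add[of "m - n" n f] by simp
    then show "(f ^^ (m - n)) ((f ^^ n) u) \<in> V" using nm(3) u by auto
  qed
  have orb: "(f ^^ (j * (m - n) + n)) u \<in> V" for j
  proof (induction j)
    case 0 show ?case using nm(2) u by auto
  next
    case (Suc j)
    have "(f ^^ (Suc j * (m - n) + n)) u = (f ^^ (m - n)) ((f ^^ (j * (m - n) + n)) u)"
      using funpow_add[of "m - n" "j * (m - n) + n" f] by (simp add: add.assoc)
    then show ?case using Suc inv by auto
  qed
  obtain B where B: "\<And>v. v \<in> V \<Longrightarrow> norm v \<le> B" using True by (auto simp: bounded_iff)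
  have "bounded_along f {u} (range (\<lambda>j. j * (m - n) + n))"
    unfolding bounded_along_def using B orb by (intro exI[of _ B]) auto
  moreover have "inj (\<lambda>j. j * (m - n) + n)" using nm(1) by (auto intro!: injI)
  then have "infinite (range (\<lambda>j. j * (m - n) + n))" using finite_imageD infinite_UNIV_nat by blast
  ultimately show False using escaping_U[OF u] by (simp add: escaping_def)
next
  case False
  obtain v where v: "v \<in> V" using Fatou_componentD(3)[OF V] by blast
  obtain u where u: "u \<in> U" using Fatou_componentD(3)[OF U] by blast
  obtain i0 where i0: "\<And>i. i \<ge> i0 \<Longrightarrow> ball 0 (rmin i) \<subseteq> (f ^^ i) ` D \<and> norm v + 1 \<le> rmin i"
    using eventually_conj[OF eventually_ball_subset_image rmin_at_top[of "norm v + 1"]]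
    by (auto simp: eventually_sequentially)
  \<comment> \<open>An unbounded \<open>V\<close> never fits into a bounded image of
    \<open>D\<close>, so every late image of \<open>U\<close> lies in \<open>V\<close>.\<close>
  have img: "(f ^^ i) ` U \<subseteq> V" if "i \<ge> i0" for i
  proof -
    have "norm v < rmin i" using i0[OF that] by simp
    moreover have "\<not> V \<subseteq> (f ^^ i) ` D" using False bounded_image_hole bounded_subset by blast
    ultimately show ?thesis
      using component_subset_image_or_contains[OF V _ v] i0[OF that] by blast
  qed
  \<comment> \<open>Two consecutive images are joined so that \<open>w\<close> and
    \<open>f w\<close> become values of the same iterate \<open>f ^^ n\<close> on \<open>K\<close>,
    where Harnack's inequality compares them.\<close>
  define K where "K = (f ^^ i0) ` frontier D \<union> (f ^^ Suc i0) ` frontier D"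
  have "(f ^^ i) ` frontier D \<subseteq> V" if "i \<ge> i0" for i using img[OF that] D(4) by blast
  then have "K \<subseteq> V" unfolding K_def by (simp del: funpow.simps)
  moreover have "compact K"
    unfolding K_def by (intro compact_Un compact_continuous_image compact_frontier cont_funpow)
  ultimately have K: "compact K" "K \<subseteq> V" by auto
  have "escaping f ((f ^^ i0) u)" using escaping_funpow[OF escaping_U[OF u]] .
  moreover have "(f ^^ i0) u \<in> V" using img[of i0] u by blast
  ultimately obtain C where C: "C > 0" "\<forall>\<^sub>F n in sequentially. \<forall>x\<in>K. \<forall>y\<in>K.
      1 < norm ((f ^^ n) x) \<and> ln (norm ((f ^^ n) x)) \<le> C * ln (norm ((f ^^ n) y))"
    using Harnack_compact[OF hol V _ _ K] by blast
  obtain k where k: "C \<le> real k" using real_arch_simple by blast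
  have "\<exists>E. open E \<and> bounded E \<and> ball 0 R \<subseteq> E \<and>
           (\<forall>w\<in>frontier E. norm (f w) \<le> 1 * norm w ^ k)" for R
  proof -
    obtain N1 where N1: "\<And>n. n \<ge> N1 \<Longrightarrow> R \<le> rmin n"
      using rmin_at_top[of R] by (auto simp: eventually_sequentially)
    obtain N2 where N2: "\<And>n. n \<ge> N2 \<Longrightarrow> \<forall>x\<in>K. \<forall>y\<in>K.
      1 < norm ((f ^^ n) x) \<and> ln (norm ((f ^^ n) x)) \<le> C * ln (norm ((f ^^ n) y))"
      using C(2) unfolding eventually_sequentially by blast
    define n where "n = max N1 N2"
    define i where "i = n + i0"
    have "norm (f w) \<le> 1 * norm w ^ k" if w: "w \<in> frontier ((f ^^ i) ` D)" for w
    proof -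
      obtain y where y: "y \<in> frontier D" "w = (f ^^ i) y" using frontier_image_hole w by blast
      have eq: "w = (f ^^ n) ((f ^^ i0) y)" "f w = (f ^^ n) ((f ^^ Suc i0) y)"
        using y(2) by (simp_all add: i_def funpow_add funpow_swap1)
      have "(f ^^ i0) y \<in> K" "(f ^^ Suc i0) y \<in> K" using y(1) unfolding K_def by blast+
      then have 1: "1 < norm w" "1 < norm (f w)" "ln (norm (f w)) \<le> C * ln (norm w)"
        unfolding eq(2) unfolding eq(1) using N2[of n] by (auto simp: n_def simp del: funpow.simps)
      have "C * ln (norm w) \<le> real k * ln (norm w)" using k 1(1) by (intro mult_right_mono) auto
      then have "ln (norm (f w)) \<le> ln (norm w ^ k)" using 1 by (simp add: ln_realpow)
      moreover have "0 < norm w" "0 < norm (f w)" using 1 by auto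
      ultimately show ?thesis by (subst (asm) ln_le_cancel_iff) simp_all
    qed
    moreover have "ball 0 R \<subseteq> (f ^^ i) ` D"
    proof -
      have "R \<le> rmin i" using N1[of i] by (simp add: i_def n_def)
      then have "ball 0 R \<subseteq> ball (0::complex) (rmin i)" by (rule subset_ball)
      then show ?thesis using i0[of i] by (auto simp: i_def)
    qed
    ultimately show ?thesis
      using open_image_hole[of i] bounded_image_hole[of i] by (intro exI[of _ "(f ^^ i) ` D"] conjI ballI)
  qed
  from polynomial_if_growth_on_frontiers[OF hol this] show False
    using transc by (auto simp: transcendental_entire_def)
qed

text \<open>If neither image of the hole enclosed \<open>V\<close>, then \<open>V\<close> would
  contain two consecutive images of \<open>U\<close>.\<close>

lemma component_subset_image_of_hole:
  assumes V: "V \<in> Fatou_components f" and v: "v \<in> V"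
    and n: "ball 0 (rmin n) \<subseteq> (f ^^ n) ` D" "norm v < rmin n"
    and Suc_n: "ball 0 (rmin (Suc n)) \<subseteq> (f ^^ Suc n) ` D" "norm v < rmin (Suc n)"
  shows "V \<subseteq> (f ^^ n) ` D \<or> V \<subseteq> (f ^^ Suc n) ` D"
  using component_subset_image_or_contains[OF V n(1) v n(2)]
    component_subset_image_or_contains[OF V Suc_n(1) v Suc_n(2)]
    component_contains_at_most_one_image[OF V lessI] by blast

lemma component_bounded:
  assumes V: "V \<in> Fatou_components f"
  shows "bounded V"
proof -
  obtain v where v: "v \<in> V" using Fatou_componentD(3)[OF V] by blast
  obtain i0 where i0: "\<And>i. i \<ge> i0 \<Longrightarrow> ball 0 (rmin i) \<subseteq> (f ^^ i) ` D \<and> norm v + 1 \<le> rmin i"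
    using eventually_conj[OF eventually_ball_subset_image rmin_at_top[of "norm v + 1"]]
    by (auto simp: eventually_sequentially)
  have "norm v < rmin i0" "norm v < rmin (Suc i0)" using i0[of i0] i0[of "Suc i0"] by auto
  then have "V \<subseteq> (f ^^ i0) ` D \<or> V \<subseteq> (f ^^ Suc i0) ` D"
    using component_subset_image_of_hole[OF V v] i0[of i0] i0[of "Suc i0"] by auto
  then show ?thesis using bounded_image_hole bounded_subset by blast
qed

end

section \<open>The size of Fatou components\<close>

text \<open>Since \<open>U\<close> is bounded, the frontier of its image comes from the frontier of
  \<open>U\<close>, which lies in the Julia set. So the image is open and has no frontier point in
  the connected \<open>W\<close>, hence fills it.\<close>

lemma (in Fatou_hole) image_U_component: "(f ^^ n) ` U \<in> Fatou_components f"
proof -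
  obtain u where u: "u \<in> U" using Fatou_componentD(3)[OF U] by blast
  have "(f ^^ n) u \<in> Fatou_set f" using u Fatou_componentD(4)[OF U] Fatou_set_funpow[OF transc] by blast
  then obtain W where W: "W \<in> Fatou_components f" "(f ^^ n) u \<in> W" by (rule in_some_Fatou_component)
  have sub: "(f ^^ n) ` U \<subseteq> W" by (rule image_funpow_subset_component[OF transc U W(1) u W(2)])
  have op: "open ((f ^^ n) ` U)" using open_image_funpow[OF transc Fatou_componentD(1)[OF U]] .
  have "W \<subseteq> (f ^^ n) ` U"
  proof (rule ccontr)
    assume "\<not> ?thesis"
    then have "W \<inter> frontier ((f ^^ n) ` U) \<noteq> {}"
      using u W(2) Fatou_componentD(2)[OF W(1)] by (intro connected_Int_frontier) auto
    then obtain v where v: "v \<in> frontier U" "(f ^^ n) v \<in> W"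
      using frontier_image_subset[OF cont_funpow component_bounded[OF U] op] by blast
    then have "v \<in> Fatou_set f"
      using Fatou_componentD(4)[OF W(1)] Fatou_set_funpow[OF transc] by blast
    then show False using frontier_Fatou_component[OF U] v(1) by blast
  qed
  then show ?thesis using sub W(1) by (metis subset_antisym)
qed

lemma (in Fatou_hole) rmax_add_le: "rmax (j + n) \<le> max_modulus (rmax n) (f ^^ j)"
proof -
  obtain w where w: "w \<in> frontier D" "norm ((f ^^ (j + n)) w) = rmax (j + n)" using rmax_attained by blast
  then show ?thesis
    using max_modulus_ge[OF holomorphic_funpow[OF hol], of "(f ^^ n) w" "rmax n" j] rmax_ge[OF w(1)]
    by (simp add: funpow_add)
qed

text \<open>\<open>N\<close> is the least index, not below a fixed threshold \<open>n0\<close>, from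
  which on \<open>rmin\<close> exceeds \<open>x\<close>. Just before it \<open>rmin\<close> is at
  most \<open>x\<close>, so Harnack bounds \<open>rmax\<close> there by a power of \<open>x\<close>,
  and \<open>j + 1\<close> further iterations cost one exponential. \<open>J\<close> lists how far
  beyond \<open>N\<close> the images are needed.\<close>

lemma (in Fatou_hole) image_radius_bound:
  assumes J: "finite J" and c: "\<forall>\<^sub>F r in at_top. \<forall>j\<in>J. max_modulus r (f ^^ Suc j) \<le> exp (r powr c)"
  shows "\<exists>A C. 0 < C \<and> (\<forall>x\<ge>0. \<exists>N\<ge>1. \<forall>j\<in>J. ball 0 (rmin (N + j)) \<subseteq> (f ^^ (N + j)) ` D \<and>
     x < rmin (N + j) \<and> (rmax (N + j) \<le> A \<or> rmax (N + j) \<le> exp ((x + 3) powr C)))"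
proof -
  obtain C where C: "C > 0" "\<forall>\<^sub>F n in sequentially. 1 < rmin n \<and> rmax n \<le> rmin n powr C"
    using rmax_le_rmin_powr by blast
  obtain R where R: "\<And>r. r \<ge> R \<Longrightarrow> \<forall>j\<in>J. max_modulus r (f ^^ Suc j) \<le> exp (r powr c)"
    using c by (auto simp: eventually_at_top_linorder)
  obtain n0 where n0: "\<And>n. n \<ge> n0 \<Longrightarrow> (1 < rmin n \<and> rmax n \<le> rmin n powr C) \<and>
      R \<le> rmin n \<and> ball 0 (rmin n) \<subseteq> (f ^^ n) ` D \<and> 1 \<le> n"
    using eventually_conj[OF C(2) eventually_conj[OF rmin_at_top[of R]
        eventually_conj[OF eventually_ball_subset_image eventually_ge_at_top[of 1]]]]
    unfolding eventually_sequentially by blast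
  \<comment> \<open>Covers the case \<open>N = n0\<close>, where no earlier index is available for
    comparison.\<close>
  define A where "A = (\<Sum>j\<in>J. rmax (n0 + j))"
  \<comment> \<open>\<open>c\<close> may be negative; \<open>max c 1\<close> keeps the exponents
    positive, so that \<open>powr\<close> is monotone in its base.\<close>
  define C' where "C' = C * max c 1"
  have rmax0: "0 \<le> rmax n" for n using rmax_attained[of n] norm_ge_zero by metis
  have "\<exists>N\<ge>1. \<forall>j\<in>J. ball 0 (rmin (N + j)) \<subseteq> (f ^^ (N + j)) ` D \<and>
     x < rmin (N + j) \<and> (rmax (N + j) \<le> A \<or> rmax (N + j) \<le> exp ((x + 3) powr C'))" if x: "0 \<le> x" for x
  proof -
    define P where "P n \<longleftrightarrow> n \<ge> n0 \<and> (\<forall>m\<ge>n. x < rmin m)" for n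
    define N where "N = (LEAST n. P n)"
    obtain n1 where n1: "\<And>m. m \<ge> n1 \<Longrightarrow> x + 1 \<le> rmin m"
      using rmin_at_top[of "x + 1"] unfolding eventually_sequentially by blast
    have "P (max n0 n1)" unfolding P_def using n1 by (force simp: less_le_trans)
    then have PN: "P N" unfolding N_def by (rule LeastI)
    have "ball 0 (rmin (N + j)) \<subseteq> (f ^^ (N + j)) ` D \<and>
     x < rmin (N + j) \<and> (rmax (N + j) \<le> A \<or> rmax (N + j) \<le> exp ((x + 3) powr C'))" if j: "j \<in> J" for j
    proof (intro conjI)
      show "ball 0 (rmin (N + j)) \<subseteq> (f ^^ (N + j)) ` D" using n0[of "N + j"] PN by (auto simp: P_def)
      show "x < rmin (N + j)" using PN by (auto simp: P_def)
      show "rmax (N + j) \<le> A \<or> rmax (N + j) \<le> exp ((x + 3) powr C')"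
      proof (cases "N = n0")
        case True
        have "rmax (n0 + j) \<le> A"
          unfolding A_def using member_le_sum[of j J "\<lambda>j. rmax (n0 + j)"] j J rmax0 by simp
        then have "rmax (N + j) \<le> A" using True by simp
        then show ?thesis ..
      next
        case False
        then have gt: "N > n0" using PN by (auto simp: P_def)
        then obtain M where M: "N = Suc M" "M \<ge> n0" by (cases N) auto
        have "\<not> P M" using not_less_Least[of M P] M(1) unfolding N_def by simp
        then obtain m where m: "m \<ge> M" "\<not> x < rmin m" using M(2) by (auto simp: P_def)
        have "m = M" using m PN M(1) by (cases "m = M") (auto simp: P_def)
        then have rx: "rmin M \<le> x" using m(2) by simp
        have 1: "1 < rmin M" "rmax M \<le> rmin M powr C" "R \<le> rmax M"
          using n0[OF M(2)] rmin_le_rmax[of M] by auto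
        have "rmax M powr c \<le> rmax M powr max c 1"
          using 1(1) rmin_le_rmax[of M] by (intro powr_mono) auto
        also have "\<dots> \<le> (rmin M powr C) powr max c 1"
          using 1 rmax0[of M] by (intro powr_mono2) auto
        also have "\<dots> = rmin M powr C'" by (simp add: powr_powr C'_def)
        also have "\<dots> \<le> (x + 3) powr C'"
          using 1(1) rx C(1) by (intro powr_mono2) (auto simp: C'_def)
        finally have 2: "rmax M powr c \<le> (x + 3) powr C'" .
        have "rmax (N + j) = rmax (Suc j + M)" by (simp add: M(1) add.commute)
        also have "\<dots> \<le> max_modulus (rmax M) (f ^^ Suc j)" by (rule rmax_add_le)
        also have "\<dots> \<le> exp (rmax M powr c)" using R[OF 1(3)] j by blast
        also have "\<dots> \<le> exp ((x + 3) powr C')" using 2 by simp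
        finally show ?thesis ..
      qed
    qed
    moreover have "1 \<le> N" using PN n0[of N] by (simp add: P_def)
    ultimately show ?thesis by blast
  qed
  moreover have "0 < C'" using C(1) by (simp add: C'_def)
  ultimately show ?thesis by blast
qed

section \<open>From order and pairwise estimates to the ratios over components\<close>

lemma finite_growth_order:
  assumes "growth_order g < \<infinity>" and M: "\<forall>\<^sub>F r in at_top. 1 < max_modulus r g"
  shows "\<exists>c. \<forall>\<^sub>F r in at_top. max_modulus r g \<le> exp (r powr c)"
proof -
  obtain c where c: "growth_order g < ereal c" using assms(1) less_PInf_Ex_of_nat by auto
  then have "\<forall>\<^sub>F r in at_top. ereal (ln (ln (max_modulus r g)) / ln r) < ereal c"
    unfolding growth_order_def by (rule Limsup_lessD)
  then have "\<forall>\<^sub>F r in at_top. max_modulus r g \<le> exp (r powr c)"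
    using M eventually_gt_at_top[of 1]
  proof eventually_elim
    case (elim r)
    have l: "0 < ln (max_modulus r g)" using elim(2) by (rule ln_gt_zero)
    have "ln (ln (max_modulus r g)) \<le> c * ln r"
      using elim(1) ln_gt_zero[OF elim(3)] by (simp add: field_simps)
    then have "exp (ln (ln (max_modulus r g))) \<le> exp (c * ln r)" by (simp only: exp_le_cancel_iff)
    then have "ln (max_modulus r g) \<le> r powr c" using l elim(3) by (simp add: powr_def)
    then have "exp (ln (max_modulus r g)) \<le> exp (r powr c)" by (simp only: exp_le_cancel_iff)
    then show ?case using elim(2) by simp
  qed
  then show ?thesis by blast
qed

lemma Fatou_uniformly_boundedI:
  assumes C: "0 < C" and le: "\<And>V z w. V \<in> Fatou_components f \<Longrightarrow> z \<in> V \<Longrightarrow> w \<in> V \<Longrightarrow>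
      norm z \<le> A \<or> norm z \<le> exp ((norm w + 3) powr C)"
  shows "Fatou_uniformly_bounded f"
proof -
  \<comment> \<open>\<open>C\<close> is the coefficient in \<open>ln (x powr C) = C * ln x\<close>;
    the second summand comes from \<open>norm z + 30 \<le> 31 * exp (x powr C)\<close>, the third
    from the alternative \<open>norm z \<le> A\<close>. As \<open>ln (norm w + 3) \<ge> 1\<close>,
    both constants can be absorbed into multiples of it.\<close>
  define K where "K = C + ln (1 + ln 31) + ln (ln (max A 0 + 30))"
  have e3: "exp 1 \<le> (3::real)" by (rule exp_le)
  have ln3: "1 \<le> ln (x::real)" if "3 \<le> x" for x
  proof -
    have "0 < x" "exp 1 \<le> x" using that e3 by auto
    then show ?thesis by (simp add: ln_ge_iff)
  qed
  have p1: "0 \<le> ln (1 + ln (31::real))" using ln3[of 31] by (intro ln_ge_zero) auto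
  have p2: "0 \<le> ln (ln (max A 0 + 30))" using ln3[of "max A 0 + 30"] by (intro ln_ge_zero) auto
  have bd: "ln (ln (norm z + 30)) \<le> K * ln (norm w + 3)"
    if V: "V \<in> Fatou_components f" "z \<in> V" "w \<in> V" for V z w
  proof -
    define x where "x = norm w + 3"
    have x: "3 \<le> x" "1 \<le> ln x" "0 < x" using ln3[of x] by (auto simp: x_def intro: add_nonneg_pos)
    have lz: "1 \<le> ln (norm z + 30)" by (rule ln3) simp
    have "ln (ln (norm z + 30)) \<le> ln (ln (max A 0 + 30)) \<or>
        ln (ln (norm z + 30)) \<le> C * ln x + ln (1 + ln 31)"
      using le[OF V]
    proof
      assume "norm z \<le> A"
      then have "ln (norm z + 30) \<le> ln (max A 0 + 30)" by (subst ln_le_cancel_iff) (auto intro: add_nonneg_pos)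
      then have "ln (ln (norm z + 30)) \<le> ln (ln (max A 0 + 30))" using lz by (subst ln_le_cancel_iff) auto
      then show ?thesis ..
    next
      assume z: "norm z \<le> exp ((norm w + 3) powr C)"
      define y where "y = x powr C"
      have y: "1 \<le> y" using x C by (simp add: y_def ge_one_powr_ge_zero)
      have "norm z + 30 \<le> exp y * 31" using z y one_le_exp_iff[of y] unfolding x_def[symmetric] y_def[symmetric] by linarith
      then have "ln (norm z + 30) \<le> ln (exp y * 31)" by (subst ln_le_cancel_iff) (auto intro: add_nonneg_pos)
      also have "\<dots> = y + ln 31" by (simp add: ln_mult)
      also have "\<dots> \<le> y + y * ln 31" using y ln3[of 31] by (intro add_left_mono) (simp add: mult_le_cancel_right1)
      also have "\<dots> = y * (1 + ln 31)" by (simp add: algebra_simps)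
      finally have "ln (ln (norm z + 30)) \<le> ln (y * (1 + ln 31))"
        using lz by (subst ln_le_cancel_iff) auto
      also have "\<dots> = C * ln x + ln (1 + ln 31)"
        using y x ln3[of 31] by (subst ln_mult) (auto simp: y_def ln_powr)
      finally show ?thesis ..
    qed
    moreover have "ln (ln (max A 0 + 30)) \<le> ln (ln (max A 0 + 30)) * ln x" "ln (1 + ln 31) \<le> ln (1 + ln 31) * ln x"
      using mult_left_mono[OF x(2) p2] mult_left_mono[OF x(2) p1] by simp_all
    moreover have "0 \<le> C * ln x" using C x by simp
    ultimately have "ln (ln (norm z + 30)) \<le> C * ln x + ln (1 + ln 31) * ln x + ln (ln (max A 0 + 30)) * ln x"
      using p1 p2 by linarith
    then show ?thesis by (simp add: K_def x_def algebra_simps)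
  qed
  have K: "0 < K" unfolding K_def using add_pos_nonneg[OF add_pos_nonneg[OF C p1] p2] .
  have "B2 f \<le> ereal K"
    unfolding B2_def
  proof (rule SUP_least)
    fix V assume V: "V \<in> Fatou_components f"
    let ?S = "SUP z\<in>V. ereal (ln (ln (norm z + 30)))" and ?I = "INF w\<in>V. ereal (ln (norm w + 3))"
    obtain v where v: "v \<in> V" using Fatou_componentD(3)[OF V] by blast
    have "ereal 1 \<le> ?I" by (rule INF_greatest) (use ln3 in auto)
    then have I0: "0 < ?I" by (simp add: less_le_trans[of 0 "ereal 1"])
    have "?I \<le> ereal (ln (norm v + 3))" using v by (rule INF_lower)
    then have Ifin: "?I \<noteq> \<infinity>" by auto
    \<comment> \<open>The supremum over \<open>z\<close> is bounded for each fixed \<open>w\<close>;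
      dividing by \<open>K\<close> first lets the bound pass to the infimum over
      \<open>w\<close>.\<close>
    have "?S / ereal K \<le> ?I"
    proof (rule INF_greatest)
      fix w assume w: "w \<in> V"
      have "?S \<le> ereal K * ereal (ln (norm w + 3))"
        by (rule SUP_least) (use bd[OF V _ w] in simp)
      then show "?S / ereal K \<le> ereal (ln (norm w + 3))"
        using K by (subst ereal_divide_le_pos) auto
    qed
    then have "?S \<le> ereal K * ?I" using K by (subst (asm) ereal_divide_le_pos) auto
    then show "?S / ?I \<le> ereal K"
      using I0 Ifin by (subst ereal_divide_le_pos) (auto simp: mult.commute)
  qed
  then show ?thesis unfolding Fatou_uniformly_bounded_def by (rule le_less_trans) simp
qed

lemma B0_finiteD:
  assumes "B0 f \<noteq> \<infinity>"
  obtains K where "1 \<le> K"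
    "\<And>V z w. V \<in> Fatou_components f \<Longrightarrow> z \<in> V \<Longrightarrow> w \<in> V \<Longrightarrow> norm z + 1 \<le> K * (norm w + 1)"
proof -
  have "B0 f < \<infinity>" using assms by simp
  then obtain n :: nat where n: "B0 f < ereal (real n)" using less_PInf_Ex_of_nat by auto
  define K where "K = real n + 1"
  have "norm z + 1 \<le> K * (norm w + 1)" if V: "V \<in> Fatou_components f" "z \<in> V" "w \<in> V" for V z w
  proof -
    let ?S = "SUP z\<in>V. ereal (norm z + 1)" and ?I = "INF w\<in>V. ereal (norm w + 1)"
    have "ereal 1 \<le> ?I" by (rule INF_greatest) auto
    then have I0: "0 < ?I" by (simp add: less_le_trans[of 0 "ereal 1"])
    have Iw: "?I \<le> ereal (norm w + 1)" using V(3) by (rule INF_lower)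
    then have Ifin: "?I \<noteq> \<infinity>" by auto
    have "?S / ?I \<le> B0 f" unfolding B0_def using V(1) by (rule SUP_upper)
    also have "\<dots> \<le> ereal K" using n by (simp add: K_def order_trans[OF less_imp_le])
    finally have "?S \<le> ?I * ereal K" using I0 Ifin by (subst (asm) ereal_divide_le_pos) auto
    also have "\<dots> \<le> ereal (norm w + 1) * ereal K"
      using Iw by (rule ereal_mult_right_mono) (simp add: K_def)
    finally have "?S \<le> ereal ((norm w + 1) * K)" by simp
    moreover have "ereal (norm z + 1) \<le> ?S" using V(2) by (rule SUP_upper)
    ultimately have "ereal (norm z + 1) \<le> ereal ((norm w + 1) * K)" by (rule order_trans[rotated])
    then show ?thesis by (simp add: mult.commute)
  qed
  then show ?thesis using that[of K] by (simp add: K_def)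
qed

text \<open>If the components had bounded ratios, the rescaled iterates \<open>g n\<close> would be normal on the hole
  with unimodular values at \<open>u\<close>. Since \<open>f ^^ n\<close> has zeros in the hole, \<open>g n\<close> is small on a fixed
  disc for infinitely many \<open>n\<close>. As \<open>max_modulus (r / 2) f\<close> is negligible against
  \<open>max_modulus r f\<close>, the limit of the \<open>g (Suc n)\<close> vanishes on that disc, hence at \<open>u\<close>.\<close>
lemma (in Fatou_hole) B0_infinite: "B0 f = \<infinity>"
proof (rule ccontr)
  assume "B0 f \<noteq> \<infinity>"
  then obtain K where K: "1 \<le> K"
    "\<And>V z w. V \<in> Fatou_components f \<Longrightarrow> z \<in> V \<Longrightarrow> w \<in> V \<Longrightarrow> norm z + 1 \<le> K * (norm w + 1)"
    using B0_finiteD by metis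
  obtain u where u: "u \<in> D" "u \<in> U" using D_meets_U by blast
  define \<rho> where "\<rho> n = norm ((f ^^ n) u)" for n
  define g where "g n x = (f ^^ n) x / of_real (\<rho> n)" for n x
  \<comment> \<open>The \<open>+ 1\<close> in \<open>B0\<close> leaves an additive \<open>K\<close>,
    which is at most \<open>\<rho> n / 2\<close> once \<open>\<rho> n \<ge> 2 * K\<close>; so the
    ratios become multiplicative at the cost of a factor 2.\<close>
  have "\<forall>\<^sub>F n in sequentially. \<forall>w\<in>{u}. 2 * K \<le> norm ((f ^^ n) w)"
    by (rule escaping_locally_uniform[OF U u(2) escaping_U[OF u(2)]]) (use u in auto)
  then have evu: "\<forall>\<^sub>F n in sequentially. 2 * K \<le> \<rho> n" by (simp add: \<rho>_def)
  obtain N where N: "\<And>n. n \<ge> N \<Longrightarrow> 2 * K \<le> \<rho> n" "\<And>n. n \<ge> N \<Longrightarrow> 1 \<le> rmin n"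
    "\<And>n. n \<ge> N \<Longrightarrow> ball 0 (rmin n) \<subseteq> (f ^^ n) ` D"
    using eventually_conj[OF evu eventually_conj[OF rmin_at_top[of 1] eventually_ball_subset_image]]
    unfolding eventually_sequentially by blast
  have \<rho>1: "1 \<le> \<rho> n" if "n \<ge> N" for n using N(1)[OF that] K(1) by simp
  have ring: "norm ((f ^^ n) x) \<le> 2 * K * \<rho> n \<and> \<rho> n \<le> 2 * K * norm ((f ^^ n) x)"
    if n: "n \<ge> N" and x: "x \<in> U" for n x
  proof
    have 1: "norm ((f ^^ n) x) + 1 \<le> K * (\<rho> n + 1)" "\<rho> n + 1 \<le> K * (norm ((f ^^ n) x) + 1)"
      unfolding \<rho>_def using x u(2) by (auto intro: K(2)[OF image_U_component[of n]])
    have "K * (\<rho> n + 1) \<le> K * (2 * \<rho> n)" using \<rho>1[OF n] K(1) by (intro mult_left_mono) auto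
    then show "norm ((f ^^ n) x) \<le> 2 * K * \<rho> n" using 1(1) by (simp add: algebra_simps)
    show "\<rho> n \<le> 2 * K * norm ((f ^^ n) x)" using 1(2) N(1)[OF n] by (simp add: algebra_simps)
  qed
  have rmaxb: "rmax n \<le> 2 * K * \<rho> n" if "n \<ge> N" for n
    using rmax_attained[of n] ring[OF that] D(4) by (metis subsetD)
  have rminb: "\<rho> n \<le> 2 * K * rmin n" if "n \<ge> N" for n
    using rmin_attained[of n] ring[OF that] D(4) by (metis subsetD)
  have gb: "norm (g n x) \<le> 2 * K" if n: "n \<ge> N" and x: "x \<in> D" for n x
  proof -
    have "norm ((f ^^ n) x) \<le> 2 * K * \<rho> n" using rmax_ge_hole[OF x] rmaxb[OF n] by (rule order_trans)
    then show ?thesis using \<rho>1[OF n] by (simp add: g_def norm_divide divide_le_eq)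
  qed
  have ghol: "g n holomorphic_on D" if "n \<ge> N" for n
    unfolding g_def using \<rho>1[OF that] by (intro holomorphic_intros hol_funpow) auto
  have montel: "\<exists>G r. G holomorphic_on D \<and> strict_mono (r :: nat \<Rightarrow> nat) \<and>
      (\<forall>x\<in>D. (\<lambda>k. g (q (r k)) x) \<longlonglongrightarrow> G x) \<and>
      (\<forall>K. compact K \<longrightarrow> K \<subseteq> D \<longrightarrow> uniform_limit K (\<lambda>k. g (q (r k))) G sequentially)"
    if q: "\<And>k. q k \<ge> N" for q :: "nat \<Rightarrow> nat"
  proof -
    obtain G r where "G holomorphic_on D" "strict_mono (r :: nat \<Rightarrow> nat)"
      "\<And>x. x \<in> D \<Longrightarrow> (\<lambda>k. (\<lambda>k. g (q k)) (r k) x) \<longlonglongrightarrow> G x"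
      "\<And>K. compact K \<Longrightarrow> K \<subseteq> D \<Longrightarrow> uniform_limit K ((\<lambda>k. g (q k)) \<circ> r) G sequentially"
    proof (rule Montel[of D "g ` {N..}" "\<lambda>k. g (q k)"])
      show "\<exists>B. \<forall>h\<in>g ` {N..}. \<forall>z\<in>E. norm (h z) \<le> B" if "E \<subseteq> D" for E
        using gb that by (intro exI[of _ "2 * K"]) blast
    qed (use D(1) ghol q in auto)
    then show ?thesis by (intro exI[of _ G] exI[of _ r]) (simp add: o_def)
  qed
  \<comment> \<open>On \<open>U\<close> the iterate is comparable with \<open>\<rho> n\<close>, so
    its zeros avoid \<open>U\<close>. They lie in \<open>D - U\<close>, which is compact because the
    frontier of \<open>D\<close> is in \<open>U\<close>, and hence accumulate at a point inside
    \<open>D\<close>.\<close>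
  have "\<exists>z\<in>D - U. (f ^^ n) z = 0" if n: "n \<ge> N" for n
  proof -
    have "0 \<in> (f ^^ n) ` D" using N(2,3)[OF n] by (auto simp: subset_iff)
    then obtain z where z: "z \<in> D" "(f ^^ n) z = 0" by auto
    have "z \<notin> U" using ring[OF n, of z] z(2) \<rho>1[OF n] by auto
    then show ?thesis using z by blast
  qed
  then obtain \<zeta> where \<zeta>: "\<And>n. n \<ge> N \<Longrightarrow> \<zeta> n \<in> D - U" "\<And>n. n \<ge> N \<Longrightarrow> (f ^^ n) (\<zeta> n) = 0" by metis
  have "D - U = closure D - U" using D(1,4) closure_subset by (auto simp: frontier_def interior_open)
  then have "compact (D - U)"
    using compact_diff[of "closure D" U] D(2) Fatou_componentD(1)[OF U] by (simp add: compact_closure)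
  then have "seq_compact (D - U)" by (simp add: compact_imp_seq_compact)
  then obtain zl s where zl: "zl \<in> D - U" "strict_mono (s :: nat \<Rightarrow> nat)" "((\<lambda>k. \<zeta> (N + k)) \<circ> s) \<longlonglongrightarrow> zl"
    by (rule seq_compactE[where f = "\<lambda>k. \<zeta> (N + k)"]) (use \<zeta>(1) in auto)
  obtain G r where G: "G holomorphic_on D" "strict_mono (r :: nat \<Rightarrow> nat)"
    "\<And>K. compact K \<Longrightarrow> K \<subseteq> D \<Longrightarrow> uniform_limit K (\<lambda>k. g (N + s (r k))) G sequentially"
    using montel[of "\<lambda>k. N + s k"] by auto
  define m where "m k = N + s (r k)" for k
  have mN: "m k \<ge> N" for k by (simp add: m_def)
  have "strict_mono (s \<circ> r)" using zl(2) G(2) by (rule strict_mono_o)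
  then have m_ge: "k \<le> m k" for k using seq_suble[of "s \<circ> r" k] by (simp add: m_def)
  have mlim: "(\<lambda>k. \<zeta> (m k)) \<longlonglongrightarrow> zl"
    using LIMSEQ_subseq_LIMSEQ[OF zl(3) G(2)] by (simp add: m_def o_def)
  \<comment> \<open>Chosen so that \<open>\<eta> * (2 * K * rmin n)\<close> is
    \<open>rmin n / 4\<close>, half the radius \<open>rmin n / 2\<close> of a circle inside the
    covered disc.\<close>
  define \<eta> where "\<eta> = 1 / (8 * K)"
  have \<eta>: "\<eta> > 0" using K(1) by (simp add: \<eta>_def)
  obtain e0 where e0: "e0 > 0" "cball zl e0 \<subseteq> D" using zl(1) D(1) open_contains_cball by blast
  have Gcont: "continuous_on D G" using G(1) by (rule holomorphic_on_imp_continuous_on)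
  have ul: "uniform_limit (cball zl e0) (\<lambda>k. g (m k)) G sequentially"
    using G(3)[OF compact_cball e0(2)] by (simp add: m_def)
  \<comment> \<open>Uniform convergence near the accumulation point carries the zeros of
    \<open>g (m k)\<close> over to the limit.\<close>
  have Gzl: "G zl = 0"
  proof -
    have "isCont G zl" using Gcont zl(1) D(1) by (simp add: continuous_on_eq_continuous_at)
    then have 1: "(\<lambda>k. G (\<zeta> (m k))) \<longlonglongrightarrow> G zl" using mlim isCont_tendsto_compose by blast
    have inb: "\<forall>\<^sub>F k in sequentially. \<zeta> (m k) \<in> cball zl e0"
      using tendstoD[OF mlim e0(1)] by (rule eventually_mono) (simp add: dist_commute less_imp_le)
    have "(\<lambda>k. G (\<zeta> (m k))) \<longlonglongrightarrow> 0"
    proof (rule tendstoI)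
      fix \<epsilon> :: real assume "\<epsilon> > 0"
      then have "\<forall>\<^sub>F k in sequentially. \<forall>x\<in>cball zl e0. dist (g (m k) x) (G x) < \<epsilon>"
        by (rule uniform_limitD[OF ul])
      then show "\<forall>\<^sub>F k in sequentially. dist (G (\<zeta> (m k))) 0 < \<epsilon>"
        using inb
      proof eventually_elim
        case (elim k)
        then have "dist (g (m k) (\<zeta> (m k))) (G (\<zeta> (m k))) < \<epsilon>" by blast
        then show ?case using \<zeta>(2)[OF mN] by (simp add: g_def)
      qed
    qed
    then show ?thesis using 1 LIMSEQ_unique by blast
  qed
  have "zl \<in> D" using zl(1) by blast
  with Gcont half_gt_zero[OF \<eta>] obtain e1 where "e1 > 0"
    "\<forall>x\<in>D. dist x zl < e1 \<longrightarrow> dist (G x) (G zl) < \<eta> / 2"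
    unfolding continuous_on_iff by blast
  then obtain e1 where e1: "e1 > 0" "\<And>x. dist x zl < e1 \<Longrightarrow> x \<in> D \<Longrightarrow> norm (G x) < \<eta> / 2"
    using Gzl by (metis dist_0_norm dist_commute)
  define e where "e = min e0 e1"
  have e: "e > 0" "ball zl e \<subseteq> D" using e0 e1(1) by (auto simp: e_def)
  have small: "\<forall>\<^sub>F k in sequentially. \<forall>x\<in>ball zl e. norm (g (m k) x) < \<eta>"
    using uniform_limitD[OF ul half_gt_zero[OF \<eta>]]
  proof (rule eventually_mono)
    fix k assume k: "\<forall>x\<in>cball zl e0. dist (g (m k) x) (G x) < \<eta> / 2"
    show "\<forall>x\<in>ball zl e. norm (g (m k) x) < \<eta>"
    proof
      fix x assume x: "x \<in> ball zl e"
      then have "x \<in> D" "x \<in> cball zl e0" "dist x zl < e1" using e(2) by (auto simp: e_def dist_commute)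
      then have "dist (g (m k) x) (G x) < \<eta> / 2" "norm (G x) < \<eta> / 2" using k e1(2) by blast+
      then show "norm (g (m k) x) < \<eta>"
        using norm_triangle_sub[of "g (m k) x" "G x"] by (simp add: dist_norm)
    qed
  qed
  have tiny: "\<forall>\<^sub>F k in sequentially. \<forall>x\<in>ball zl e. norm (g (Suc (m k)) x) \<le> \<epsilon>" if \<epsilon>: "\<epsilon> > 0" for \<epsilon>
  proof -
    obtain R where R: "R \<ge> 1" "\<And>r. r \<ge> R \<Longrightarrow> max_modulus (r / 2) f \<le> \<epsilon> / (2 * K) * max_modulus r f"
      using max_modulus_half[OF transc, of "\<epsilon> / (2 * K)"] \<epsilon> K(1) by auto
    obtain N1 where N1: "\<And>n. n \<ge> N1 \<Longrightarrow> 2 * R \<le> rmin n"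
      using rmin_at_top[of "2 * R"] unfolding eventually_sequentially by blast
    show ?thesis using small eventually_ge_at_top[of N1]
    proof eventually_elim
      case (elim k)
      define n where "n = m k"
      have n: "n \<ge> N" "n \<ge> N1" "Suc n \<ge> N" using mN[of k] m_ge[of k] elim(2) by (auto simp: n_def)
      have "norm (g (Suc n) x) \<le> \<epsilon>" if x: "x \<in> ball zl e" for x
      proof -
        have "norm (g n x) < \<eta>" using elim(1) x by (simp add: n_def)
        then have "norm ((f ^^ n) x) \<le> \<eta> * \<rho> n"
          using \<rho>1[OF n(1)] by (simp add: g_def norm_divide divide_less_eq)
        also have "\<dots> \<le> \<eta> * (2 * K * rmin n)" using rminb[OF n(1)] \<eta> by (intro mult_left_mono) auto
        also have "\<dots> = (rmin n / 2) / 2" using K(1) by (simp add: \<eta>_def)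
        finally have "norm (f ((f ^^ n) x)) \<le> max_modulus ((rmin n / 2) / 2) f"
          by (rule max_modulus_ge[OF hol])
        also have "\<dots> \<le> \<epsilon> / (2 * K) * max_modulus (rmin n / 2) f"
          by (rule R(2)) (use N1[OF n(2)] in simp)
        also have "\<dots> \<le> \<epsilon> / (2 * K) * (2 * K * \<rho> (Suc n))"
        proof (rule mult_left_mono)
          \<comment> \<open>The circle of radius \<open>rmin n / 2\<close> lies in the image of
            \<open>D\<close>, so the maximum modulus of \<open>f\<close> on it is attained as a
            value of the next iterate on \<open>D\<close>, at most
            \<open>rmax (Suc n)\<close>.\<close>
          obtain y where y: "norm y = rmin n / 2" "norm (f y) = max_modulus (rmin n / 2) f"
            using max_modulus_attained[OF hol, of "rmin n / 2"] N(2)[OF n(1)] by auto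
          have "y \<in> ball 0 (rmin n)" using y(1) N(2)[OF n(1)] by simp
          then obtain v where v: "v \<in> D" "y = (f ^^ n) v" using N(3)[OF n(1)] by blast
          have "norm ((f ^^ Suc n) v) \<le> rmax (Suc n)" using rmax_ge_hole[OF v(1)] .
          then show "max_modulus (rmin n / 2) f \<le> 2 * K * \<rho> (Suc n)"
            using rmaxb[OF n(3)] y(2) v(2) by simp
        qed (use \<epsilon> K(1) in auto)
        also have "\<dots> = \<epsilon> * \<rho> (Suc n)" using K(1) by simp
        finally show ?thesis using \<rho>1[OF n(3)] by (simp add: g_def norm_divide divide_le_eq)
      qed
      then show ?case by (simp add: n_def)
    qed
  qed
  obtain H r' where H: "H holomorphic_on D" "strict_mono (r' :: nat \<Rightarrow> nat)"
    "\<And>x. x \<in> D \<Longrightarrow> (\<lambda>k. g (Suc (m (r' k))) x) \<longlonglongrightarrow> H x"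
    using montel[of "\<lambda>k. Suc (m k)"] mN le_SucI by metis
  have H0: "H x = 0" if x: "x \<in> ball zl e" for x
  proof -
    have "(\<lambda>k. g (Suc (m k)) x) \<longlonglongrightarrow> 0"
    proof (rule tendstoI)
      fix \<epsilon> :: real assume "\<epsilon> > 0"
      show "\<forall>\<^sub>F k in sequentially. dist (g (Suc (m k)) x) 0 < \<epsilon>"
      proof (rule eventually_mono[OF tiny[OF half_gt_zero[OF \<open>\<epsilon> > 0\<close>]]])
        fix k assume "\<forall>x\<in>ball zl e. norm (g (Suc (m k)) x) \<le> \<epsilon> / 2"
        then have "norm (g (Suc (m k)) x) \<le> \<epsilon> / 2" using x by blast
        then show "dist (g (Suc (m k)) x) 0 < \<epsilon>" using \<open>\<epsilon> > 0\<close> by simp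
      qed
    qed
    then have "(\<lambda>k. g (Suc (m (r' k))) x) \<longlonglongrightarrow> 0"
      using LIMSEQ_subseq_LIMSEQ[OF _ H(2)] by (simp add: o_def)
    moreover have "x \<in> D" using x e(2) by blast
    ultimately show ?thesis using H(3) LIMSEQ_unique by blast
  qed
  have "H u = 0"
  proof (rule analytic_continuation[OF H(1) D(1,3), of "ball zl e" zl])
    show "zl islimpt ball zl e" using e(1) by (simp add: islimpt_ball)
  qed (use e(2) zl(1) H0 u(1) in auto)
  moreover have "norm (H u) = 1"
  proof -
    have "norm (g (Suc (m (r' k))) u) = 1" for k
    proof -
      have "1 \<le> \<rho> (Suc (m (r' k)))" using \<rho>1 mN le_SucI by blast
      then have "norm (g (Suc (m (r' k))) u) = \<rho> (Suc (m (r' k))) / \<rho> (Suc (m (r' k)))"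
        unfolding g_def norm_divide \<rho>_def by simp
      then show ?thesis using \<open>1 \<le> \<rho> (Suc (m (r' k)))\<close> by simp
    qed
    then show ?thesis using tendsto_norm[OF H(3)[OF u(1)]] LIMSEQ_unique[OF tendsto_const] by force
  qed
  ultimately show False by simp
qed

section \<open>Consequences of the two growth hypotheses\<close>

lemma Fatou_hole_of_multiply_connected:
  assumes "transcendental_entire f" "U \<in> Fatou_components f" "multiply_connected U"
  obtains D p where "Fatou_hole f U D p"
  using multiply_connected_hole[OF assms(2,3)] assms(1,2) unfolding Fatou_hole_def by metis

lemma eventually_max_modulus_gt_1:
  assumes "transcendental_entire f"
  shows "\<forall>\<^sub>F r in at_top. 1 < max_modulus r f"
  using transcendental_growth[OF assms, of 1 0] by (auto simp: eventually_at_top_linorder)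

text \<open>From the index before \<open>N\<close>, the two images that may enclose a component are
  reached by \<open>f\<close> and by \<open>f \<circ> f\<close>; hence the offsets
  \<open>{0, 1}\<close> and the need for growth bounds on both maps.\<close>

lemma (in Fatou_hole) uniformly_bounded_if_finite_order_comp:
  assumes "growth_order (f \<circ> f) < \<infinity>"
  shows "Fatou_uniformly_bounded f"
proof -
  obtain \<rho>0 where "\<rho>0 \<ge> 1" "\<forall>\<rho>\<ge>\<rho>0. max_modulus \<rho> f \<le> max_modulus \<rho> (f \<circ> f)"
    using max_modulus_le_comp[OF transc] by blast
  then have ff: "\<forall>\<^sub>F r in at_top. max_modulus r f \<le> max_modulus r (f \<circ> f)"
    by (auto simp: eventually_at_top_linorder)
  have "\<forall>\<^sub>F r in at_top. 1 < max_modulus r (f \<circ> f)"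
    using ff eventually_max_modulus_gt_1[OF transc] by eventually_elim simp
  then obtain c where c: "\<forall>\<^sub>F r in at_top. max_modulus r (f \<circ> f) \<le> exp (r powr c)"
    using finite_growth_order[OF assms] by blast
  have ev: "\<forall>\<^sub>F r in at_top. \<forall>j\<in>{0, 1}. max_modulus r (f ^^ Suc j) \<le> exp (r powr c)"
    using ff c by eventually_elim (auto simp: o_def)
  obtain A C where C: "0 < C" "\<And>x. x \<ge> 0 \<Longrightarrow> \<exists>N\<ge>1. \<forall>j\<in>{0, 1}. ball 0 (rmin (N + j)) \<subseteq> (f ^^ (N + j)) ` D \<and>
     x < rmin (N + j) \<and> (rmax (N + j) \<le> A \<or> rmax (N + j) \<le> exp ((x + 3) powr C))"
    using image_radius_bound[OF _ ev] by auto
  show ?thesis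
  proof (rule Fatou_uniformly_boundedI[OF C(1)])
    fix V z w assume V: "V \<in> Fatou_components f" "z \<in> V" "w \<in> V"
    obtain N where N: "\<forall>j\<in>{0, 1}. ball 0 (rmin (N + j)) \<subseteq> (f ^^ (N + j)) ` D \<and>
     norm w < rmin (N + j) \<and> (rmax (N + j) \<le> A \<or> rmax (N + j) \<le> exp ((norm w + 3) powr C))"
      using C(2)[of "norm w"] by auto
    have "V \<subseteq> (f ^^ N) ` D \<or> V \<subseteq> (f ^^ Suc N) ` D"
      using component_subset_image_of_hole[OF V(1,3), of N] N by simp
    then have "\<exists>j\<in>{0, 1}. V \<subseteq> (f ^^ (N + j)) ` D" by simp
    then obtain j where j: "j \<in> {0, 1}" "V \<subseteq> (f ^^ (N + j)) ` D" by blast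
    then have "norm z \<le> rmax (N + j)" using V(2) rmax_ge_hole by blast
    then show "norm z \<le> A \<or> norm z \<le> exp ((norm w + 3) powr C)" using N j(1) by fastforce
  qed
qed

text \<open>A component can be the image of at most one of the two multiply connected components,
  so one of the two families of holes encloses it without passing to the next image.\<close>
lemma uniformly_bounded_if_two_orbits:
  assumes H1: "Fatou_hole f U D p" and H2: "Fatou_hole f U' D' p'" and fin: "growth_order f < \<infinity>"
    and diff: "\<And>m n. 1 \<le> m \<Longrightarrow> 1 \<le> n \<Longrightarrow> (f ^^ m) ` U \<noteq> (f ^^ n) ` U'"
  shows "Fatou_uniformly_bounded f"
proof -
  interpret A: Fatou_hole f U D p by (rule H1)
  interpret B: Fatou_hole f U' D' p' by (rule H2)
  obtain c where c: "\<forall>\<^sub>F r in at_top. max_modulus r f \<le> exp (r powr c)"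
    using finite_growth_order[OF fin eventually_max_modulus_gt_1[OF A.transc]] by blast
  \<comment> \<open>Only the image at \<open>N\<close> itself is needed for each hole, so only the
    growth of \<open>f\<close> enters.\<close>
  have ev: "\<forall>\<^sub>F r in at_top. \<forall>j\<in>{0}. max_modulus r (f ^^ Suc j) \<le> exp (r powr c)"
    using c by simp
  obtain A C where C: "0 < C" "\<And>x. x \<ge> 0 \<Longrightarrow> \<exists>N\<ge>1. ball 0 (A.rmin N) \<subseteq> (f ^^ N) ` D \<and>
     x < A.rmin N \<and> (A.rmax N \<le> A \<or> A.rmax N \<le> exp ((x + 3) powr C))"
    using A.image_radius_bound[OF _ ev] by auto
  obtain A' C' where C': "0 < C'" "\<And>x. x \<ge> 0 \<Longrightarrow> \<exists>N\<ge>1. ball 0 (B.rmin N) \<subseteq> (f ^^ N) ` D' \<and>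
     x < B.rmin N \<and> (B.rmax N \<le> A' \<or> B.rmax N \<le> exp ((x + 3) powr C'))"
    using B.image_radius_bound[OF _ ev] by auto
  show ?thesis
  proof (rule Fatou_uniformly_boundedI[of "max C C'" f "max A A'"])
    show "0 < max C C'" using C(1) by simp
    fix V z w assume V: "V \<in> Fatou_components f" "z \<in> V" "w \<in> V"
    obtain N where N: "N \<ge> 1" "ball 0 (A.rmin N) \<subseteq> (f ^^ N) ` D" "norm w < A.rmin N"
      "A.rmax N \<le> A \<or> A.rmax N \<le> exp ((norm w + 3) powr C)" using C(2)[of "norm w"] by auto
    obtain M where M: "M \<ge> 1" "ball 0 (B.rmin M) \<subseteq> (f ^^ M) ` D'" "norm w < B.rmin M"
      "B.rmax M \<le> A' \<or> B.rmax M \<le> exp ((norm w + 3) powr C')" using C'(2)[of "norm w"] by auto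
    have *: "(norm w + 3) powr C \<le> (norm w + 3) powr max C C'"
      "(norm w + 3) powr C' \<le> (norm w + 3) powr max C C'" by (intro powr_mono; simp)+
    \<comment> \<open>Images of \<open>U\<close> and \<open>U'\<close> are whole components, so both
      inclusions would be equalities and yield a common image with positive exponents, which
      \<open>diff\<close> excludes.\<close>
    have "\<not> ((f ^^ N) ` U \<subseteq> V \<and> (f ^^ M) ` U' \<subseteq> V)"
    proof
      assume "(f ^^ N) ` U \<subseteq> V \<and> (f ^^ M) ` U' \<subseteq> V"
      then have "(f ^^ N) ` U = V" "(f ^^ M) ` U' = V"
        using Fatou_components_eq[OF A.image_U_component[of N] V(1)] Fatou_componentD(3)[OF A.image_U_component[of N]]
          Fatou_components_eq[OF B.image_U_component[of M] V(1)] Fatou_componentD(3)[OF B.image_U_component[of M]]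
        by blast+
      then show False using diff[OF N(1) M(1)] by simp
    qed
    then have "V \<subseteq> (f ^^ N) ` D \<or> V \<subseteq> (f ^^ M) ` D'"
      using A.component_subset_image_or_contains[OF V(1) N(2) V(3) N(3)]
        B.component_subset_image_or_contains[OF V(1) M(2) V(3) M(3)] by blast
    then show "norm z \<le> max A A' \<or> norm z \<le> exp ((norm w + 3) powr max C C')"
    proof
      assume "V \<subseteq> (f ^^ N) ` D"
      then have "norm z \<le> A.rmax N" using V(2) A.rmax_ge_hole by blast
      then have "norm z \<le> A \<or> norm z \<le> exp ((norm w + 3) powr C)" using N(4) by auto
      then show ?thesis using *(1) exp_le_cancel_iff by (meson max.cobounded1 order_trans)
    next
      assume "V \<subseteq> (f ^^ M) ` D'"
      then have "norm z \<le> B.rmax M" using V(2) B.rmax_ge_hole by blast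
      then have "norm z \<le> A' \<or> norm z \<le> exp ((norm w + 3) powr C')" using M(4) by auto
      then show ?thesis using *(2) exp_le_cancel_iff by (meson max.cobounded2 order_trans)
    qed
  qed
qed

theorem theorem1:
  fixes f :: "complex \<Rightarrow> complex"
  assumes "transcendental_entire f"
    and "\<exists>U\<in>Fatou_components f. multiply_connected U"
  shows "(growth_order (f \<circ> f) < \<infinity> \<longrightarrow> Fatou_uniformly_bounded f)
       \<and> ((\<exists>\<X> \<Y>. Fatou_orbit f \<X> \<and> Fatou_orbit f \<Y> \<and> different_orbits f \<X> \<Y>
              \<and> (\<forall>U\<in>\<X>. multiply_connected U) \<and> (\<forall>V\<in>\<Y>. multiply_connected V))
            \<and> growth_order f < \<infinity>
          \<longrightarrow> Fatou_uniformly_bounded f)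
       \<and> B0 f = \<infinity>"
proof -
  obtain U where U: "U \<in> Fatou_components f" "multiply_connected U" using assms(2) by blast
  obtain D p where H: "Fatou_hole f U D p"
    using Fatou_hole_of_multiply_connected[OF assms(1) U] .
  have "Fatou_uniformly_bounded f"
    if orb: "Fatou_orbit f \<X>" "Fatou_orbit f \<Y>" "different_orbits f \<X> \<Y>"
      "\<forall>U\<in>\<X>. multiply_connected U" "\<forall>V\<in>\<Y>. multiply_connected V" "growth_order f < \<infinity>" for \<X> \<Y>
  proof -
    obtain V where V: "V \<in> \<X>" "V \<in> Fatou_components f" "multiply_connected V"
      using orb(1,4) by (auto simp: Fatou_orbit_def)
    obtain W where W: "W \<in> \<Y>" "W \<in> Fatou_components f" "multiply_connected W"
      using orb(2,5) by (auto simp: Fatou_orbit_def)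
    obtain D1 p1 where H1: "Fatou_hole f V D1 p1"
      using Fatou_hole_of_multiply_connected[OF assms(1) V(2,3)] .
    obtain D2 p2 where H2: "Fatou_hole f W D2 p2"
      using Fatou_hole_of_multiply_connected[OF assms(1) W(2,3)] .
    show ?thesis
      by (rule uniformly_bounded_if_two_orbits[OF H1 H2 orb(6)])
         (use orb(3) V(1) W(1) in \<open>auto simp: different_orbits_def\<close>)
  qed
  then show ?thesis
    using Fatou_hole.uniformly_bounded_if_finite_order_comp[OF H] Fatou_hole.B0_infinite[OF H] by blast
qed

end
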